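(* Let $1\le d\le n$ be integers, let $K$ be a field, let $S=K[x_1,\dots,x_n]$ be the polynomial ring in $n$ variables over $K$, and let $I_{n,d}\subseteq S$ be the squarefree Veronese ideal generated by all squarefree monomials of degree $d$ in $S$. (1) If $1\le d\le n\le (d+1)\left\lfloor \frac{1+\sqrt{5+4d}}{2}\right\rfloor+2d$, then $$\operatorname{sdepth}(I_{n,d})=\left\lfloor \binom{n}{d+1}\Big/\binom{n}{d}\right\rfloor+d .$$ (2) If $n>(d+1)\left\lfloor \frac{1+\sqrt{5+4d}}{2}\right\rfloor+2d$, then $$\left\lfloor \frac{d+\sqrt{d^2+4(n+1)}}{2}\right\rfloor\le \operatorname{sdepth}(I_{n,d})\le \left\lfloor \binom{n}{d+1}\Big/\binom{n}{d}\right\rfloor+d .$$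
   Context: $S=K[x_1,\dots,x_n]$ carries its natural $\mathbb{Z}^n$-grading. For a finitely generated $\mathbb{Z}^n$-graded $S$-module $M$, a Stanley decomposition of $M$ is a finite direct sum decomposition of $K$-vector spaces $\mathscr{D}: M=\bigoplus_{i=1}^{m} u_iK[Z_i]$, where each $u_i\in M$ is homogeneous (with respect to the $\mathbb{Z}^n$-grading) and each $Z_i$ is a subset of $\{x_1,\dots,x_n\}$. The Stanley depth of $\mathscr{D}$ is $\operatorname{sdepth}\mathscr{D}=\min\{|Z_i| : i=1,\dots,m\}$, and the Stanley depth of $M$ is $\operatorname{sdepth} M=\max\{\operatorname{sdepth}\mathscr{D} : \mathscr{D}\text{ is a Stanley decomposition of } M\}$. The ideal $I_{n,d}$ is regarded as a $\mathbb{Z}^n$-graded $S$-module. *)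

theory Defs
  imports Complex_Main "HOL-Library.Poly_Mapping" "HOL-Library.FuncSet" "HOL-Library.Cardinality"
begin

text \<open>
  The polynomial ring \<open>S = K[x\<^sub>1, \<dots>, x\<^sub>n]\<close> is the type \<open>('x, 'k) mpolynomial\<close>, for a field
  \<open>'k\<close> and a finite type \<open>'x\<close> of variables with \<open>CARD('x) = n\<close>: a polynomial is the finitely
  supported map from exponent vectors to coefficients, with the convolution product of
  \<^theory>\<open>HOL-Library.Poly_Mapping\<close>.
\<close>

type_synonym ('x, 'k) mpolynomial = "('x \<Rightarrow>\<^sub>0 nat) \<Rightarrow>\<^sub>0 'k"

text \<open>The subring \<open>K[Z]\<close> for a set \<open>Z\<close> of variables.\<close>

definition polys_in :: "'x set \<Rightarrow> ('x, 'k::field) mpolynomial set" where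
  "polys_in Z = {f. \<forall>t \<in> Poly_Mapping.keys f. Poly_Mapping.keys t \<subseteq> Z}"

text \<open>
  The component of \<open>S\<close> in degree \<open>a \<in> \<int>\<^sup>n\<close>; it is zero if \<open>a\<close> has a negative entry.
\<close>

definition multidegree_component :: "('x \<Rightarrow> int) \<Rightarrow> ('x, 'k::field) mpolynomial set" where
  "multidegree_component a =
     {f. \<forall>t \<in> Poly_Mapping.keys f. \<forall>i. int (Poly_Mapping.lookup t i) = a i}"

text \<open>
  \<open>M\<close> is the internal direct sum of the finitely many subgroups \<open>V i\<close>, \<open>i \<in> J\<close>: every element
  of \<open>M\<close> is a sum of elements of the \<open>V i\<close> in exactly one way, and all such sums lie in \<open>M\<close>.
\<close>

definition is_direct_sum :: "'m::ab_group_add set \<Rightarrow> 'i set \<Rightarrow> ('i \<Rightarrow> 'm set) \<Rightarrow> bool" where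
  "is_direct_sum M J V \<longleftrightarrow> bij_betw (\<lambda>v. \<Sum>i\<in>J. v i) (Pi\<^sub>E J V) M"

text \<open>
  An \<open>S\<close>-module \<open>M\<close> is given by its scalar multiplication \<open>scale\<close> and its carrier; \<open>gr a\<close>
  is the set of homogeneous elements of degree \<open>a \<in> \<int>\<^sup>n\<close> of a graded module containing \<open>M\<close>
  as a graded submodule, so that the graded components of \<open>M\<close> are \<open>M \<inter> gr a\<close>.
\<close>

definition stanley_space ::
  "(('x, 'k::field) mpolynomial \<Rightarrow> 'm \<Rightarrow> 'm) \<Rightarrow> 'm \<Rightarrow> 'x set \<Rightarrow> 'm set" where
  "stanley_space scale u Z = (\<lambda>f. scale f u) ` polys_in Z"

text \<open>
  A Stanley decomposition \<open>M = u\<^sub>1K[Z\<^sub>1] \<oplus> \<dots> \<oplus> u\<^sub>mK[Z\<^sub>m]\<close>. Freeness of \<open>u\<^sub>iK[Z\<^sub>i]\<close> over \<open>K[Z\<^sub>i]\<close> is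
  not demanded; for torsion-free \<open>M\<close>, in particular for ideals of \<open>S\<close>, it is automatic as
  soon as \<open>u\<^sub>i \<noteq> 0\<close>, and a summand with \<open>u\<^sub>i = 0\<close> can only lower the minimum below.
\<close>

definition stanley_decomposition ::
  "(('x, 'k::field) mpolynomial \<Rightarrow> 'm::ab_group_add \<Rightarrow> 'm) \<Rightarrow> (('x \<Rightarrow> int) \<Rightarrow> 'm set) \<Rightarrow> 'm set
    \<Rightarrow> nat \<Rightarrow> (nat \<Rightarrow> 'm) \<Rightarrow> (nat \<Rightarrow> 'x set) \<Rightarrow> bool" where
  "stanley_decomposition scale gr M m u Z \<longleftrightarrow>
     (\<forall>i\<in>{1..m}. u i \<in> M \<and> (\<exists>a. u i \<in> gr a)) \<and>
     is_direct_sum M {1..m} (\<lambda>i. stanley_space scale (u i) (Z i))"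

definition sdepth_decomposition :: "nat \<Rightarrow> (nat \<Rightarrow> 'x set) \<Rightarrow> nat" where
  "sdepth_decomposition m Z = Min ((\<lambda>i. card (Z i)) ` {1..m})"

text \<open>
  For \<open>M \<noteq> 0\<close> every decomposition has \<open>m \<ge> 1\<close>, so its Stanley depth is at most \<open>CARD('x)\<close>
  and the maximum ranges over a finite set. The value for \<open>M = 0\<close> is irrelevant.
\<close>

definition sdepth ::
  "(('x::finite, 'k::field) mpolynomial \<Rightarrow> 'm::ab_group_add \<Rightarrow> 'm) \<Rightarrow> (('x \<Rightarrow> int) \<Rightarrow> 'm set)
    \<Rightarrow> 'm set \<Rightarrow> nat" where
  "sdepth scale gr M =
     Max {sdepth_decomposition m Z | m u Z. stanley_decomposition scale gr M m u Z}"

definition squarefree_monomials :: "nat \<Rightarrow> ('x::finite, 'k::field) mpolynomial set" where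
  "squarefree_monomials d =
     {Poly_Mapping.single t 1 | t.
        (\<forall>i. Poly_Mapping.lookup t i \<le> 1) \<and> (\<Sum>i\<in>UNIV. Poly_Mapping.lookup t i) = d}"

text \<open>The span over \<open>S\<close> of a subset of \<open>S\<close> is the ideal it generates.\<close>

definition squarefree_veronese_ideal :: "nat \<Rightarrow> ('x::finite, 'k::field) mpolynomial set" where
  "squarefree_veronese_ideal d = module.span (*) (squarefree_monomials d)"

end

theory Submission
  imports Defs
begin

text \<open>
Write \<open>x\<^sub>A\<close> for the product of the variables in a set \<open>A\<close>. Both bounds concern the subsets of the
\<open>n\<close> variables of size at least \<open>d\<close>, which are the supports of the monomials in the ideal.

The upper bound is a count. In a decomposition whose sets \<open>Z\<close> all have at least \<open>d + k\<close> elements,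
each of the \<open>x\<^sub>A\<close> with \<open>|A| = d\<close> must be a generator up to a scalar, and its summand contains at least \<open>k\<close>
squarefree monomials of degree \<open>d + 1\<close>. Summands meet only in \<open>0\<close>, so \<open>k\<close> times the number of
\<open>d\<close>-sets is at most the number of \<open>(d + 1)\<close>-sets (\<open>stanley_decomposition_binomial_bound\<close>).

For the lower bound it suffices to partition these supports into intervals \<open>[A, f A]\<close> with
\<open>|f A| \<ge> d + k\<close>, because the spaces \<open>x\<^sub>A K[f A]\<close> then form a Stanley decomposition
(\<open>stanley_decomposition_of_interval_partition\<close>). Such a partition exists as soon as
\<open>(k + 1)(d + 1) \<le> n + 1\<close> and \<open>k (d + 1) + (k - 1)\<^sup>2 \<le> n\<close> (\<open>interval_partition\<close>). The first
condition says that \<open>k\<close> does not exceed the upper bound, since the quotient of the binomial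
coefficients is \<open>(n - d) / (d + 1)\<close>. The second one follows from the first if
\<open>k\<^sup>2 \<le> d + k + 1\<close>, which means that \<open>k\<close> is at most the floor that separates the two cases of
the theorem; and it follows from \<open>k (d + k) \<le> n + 1\<close> for \<open>k \<ge> 2\<close>, which means that \<open>d + k\<close> is at
most the lower bound in the second case.

To find the intervals, the variables are placed on a circle. A walker going round gains \<open>\<delta>\<close> at the
elements of \<open>A\<close> and pays \<open>1\<close> at each place of a set \<open>T\<close>. The places where the walk reaches a
record low are the gaps of \<open>A\<close>, and \<open>f A\<close> consists of \<open>A\<close> and its gaps. There are at least as many
gaps as a full turn lowers the walk, which is \<open>|T| - \<delta>|A|\<close> (\<open>card_gaps_ge\<close>). If that loss is less
than \<open>\<delta>\<close> and the walks of both sets compare well, intervals can only meet when the smaller set lies in the larger one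
(\<open>subset_if_intervals_meet\<close>), and then choosing uncovered sets by increasing size yields a partition
(\<open>greedy_interval_partition\<close>). The weight \<open>\<delta>\<close> is \<open>k + 1\<close> for the sets of size \<open>d\<close> and \<open>k\<close> for the
larger ones; the place sets \<open>T\<close> are made so that the walks for the different sizes can be
compared on every arc (\<open>long_intervals_exist\<close>).
\<close>

section \<open>Record lows of a walk around a circle\<close>

text \<open>
Position \<open>x\<close> of the circle with \<open>n\<close> places is met at all times congruent to \<open>x\<close> modulo \<open>n\<close>;
running through the natural numbers unrolls the circle, so that cyclic arcs become intervals.
\<close>

definition visits :: "nat \<Rightarrow> nat set \<Rightarrow> nat \<Rightarrow> int" where
  "visits n A y = (\<Sum>x<y. of_bool (x mod n \<in> A))"

text \<open>
The height of a walker who gains \<open>\<delta>\<close> at every place of \<open>A\<close> and pays \<open>1\<close> at every place of \<open>T\<close>.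
For \<open>T = {..<n}\<close> this is cyclic parenthesis matching: each element of \<open>A\<close> opens a bracket that
needs \<open>\<delta> - 1\<close> closing partners among the following places.
\<close>

definition walk :: "nat \<Rightarrow> int \<Rightarrow> nat set \<Rightarrow> nat set \<Rightarrow> nat \<Rightarrow> int" where
  "walk n \<delta> T A y = \<delta> * visits n A y - visits n T y"

text \<open>
The places where the walk reaches a height below all previous ones, that is, the closing brackets
without a partner. A place is tested on its second visit, so that a whole turn of the circle has
been seen before it.
\<close>

definition gaps :: "nat \<Rightarrow> int \<Rightarrow> nat set \<Rightarrow> nat set \<Rightarrow> nat set" where
  "gaps n \<delta> T A = {y. y < n \<and> (\<forall>x \<le> y + n. walk n \<delta> T A (Suc (y + n)) < walk n \<delta> T A x)}"

lemma visits_Suc: "visits n A (Suc y) = visits n A y + of_bool (y mod n \<in> A)"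
  by (simp add: visits_def)

lemma visits_period:
  assumes "A \<subseteq> {..<n}"
  shows "visits n A n = int (card A)"
proof -
  have "visits n A n = (\<Sum>x<n. of_bool (x \<in> A))"
    unfolding visits_def by (intro sum.cong) auto
  also have "\<dots> = int (card A)"
    using assms by (simp add: Int_absorb1)
  finally show ?thesis .
qed

lemma visits_add_period:
  assumes "A \<subseteq> {..<n}"
  shows "visits n A (y + n) = visits n A y + int (card A)"
proof (induction y)
  case 0
  show ?case
    using visits_period[OF assms] by (simp add: visits_def)
next
  case (Suc y)
  then show ?case
    by (simp add: visits_Suc)
qed

lemma walk_Suc:
  "walk n \<delta> T A (Suc y) =
    walk n \<delta> T A y + \<delta> * of_bool (y mod n \<in> A) - of_bool (y mod n \<in> T)"
  by (simp add: walk_def visits_Suc algebra_simps)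

lemma walk_Suc_ge:
  assumes "0 \<le> \<delta>"
  shows "walk n \<delta> T A y - 1 \<le> walk n \<delta> T A (Suc y)"
  using assms by (simp add: walk_Suc)

lemma walk_add_period:
  assumes "A \<subseteq> {..<n}" "T \<subseteq> {..<n}"
  shows "walk n \<delta> T A (y + n) = walk n \<delta> T A y - (int (card T) - \<delta> * int (card A))"
  unfolding walk_def visits_add_period[OF assms(1)] visits_add_period[OF assms(2)]
  by (simp add: algebra_simps)

lemma gaps_steps_down:
  assumes "y \<in> gaps n \<delta> T A" "1 \<le> \<delta>"
  shows "y \<notin> A" "y \<in> T"
proof -
  have "walk n \<delta> T A (Suc (y + n)) < walk n \<delta> T A (y + n)" "y < n"
    using assms(1) by (auto simp: gaps_def)
  then have "\<delta> * of_bool (y \<in> A) < of_bool (y \<in> T)"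
    by (simp add: walk_Suc)
  then show "y \<notin> A" "y \<in> T"
    using assms(2) by (auto simp: of_bool_def split: if_splits)
qed

text \<open>
One turn lowers the walk by \<open>|T| - \<delta>|A|\<close>, and it descends in steps of at most \<open>1\<close>. Hence in the
second turn it meets each of this many new levels for the first time at some place, and these
places are distinct gaps.
\<close>

lemma card_gaps_ge:
  assumes "A \<subseteq> {..<n}" "T \<subseteq> {..<n}" "0 \<le> \<delta>"
  shows "int (card T) - \<delta> * int (card A) \<le> int (card (gaps n \<delta> T A))"
proof -
  define H where "H = walk n \<delta> T A"
  define g where "g = int (card T) - \<delta> * int (card A)"
  define m where "m = Min (H ` {..n})"
  have m_le: "m \<le> H x" if "x \<le> n" for x
    unfolding m_def using that by (intro Min_le) auto
  have "m \<in> H ` {..n}"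
    unfolding m_def by (intro Min_in) auto
  then obtain x0 where x0: "x0 \<le> n" "H x0 = m"
    by auto
  \<comment> \<open>The second turn visits the place of the first minimum again, by \<open>g\<close> lower.\<close>
  have low: "H (x0 + n) = m - g"
    using walk_add_period[OF assms(1,2), of \<delta> x0] x0 by (simp add: H_def g_def)
  have ex: "\<exists>y. y < n \<and> y \<in> gaps n \<delta> T A \<and> H (Suc (y + n)) = m - i" if i: "i \<in> {1..g}" for i
  proof -
    define z where "z = (LEAST z. H z \<le> m - i)"
    have z: "H z \<le> m - i"
      unfolding z_def by (rule LeastI[of _ "x0 + n"]) (use low i in auto)
    have before: "m - i < H x" if "x < z" for x
      using not_less_Least[of x "\<lambda>z. H z \<le> m - i"] that by (simp add: z_def)
    have "z \<le> x0 + n"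
      unfolding z_def by (rule Least_le) (use low i in auto)
    moreover have "n < z"
      using z m_le[of z] i by (cases "z \<le> n") simp_all
    ultimately have y: "z = Suc (z - Suc n + n)" "z - Suc n < n"
      using x0(1) by auto
    define y where "y = z - Suc n"
    note y = y[folded y_def]
    have "H z = m - i"
    proof -
      have "H (y + n) - 1 \<le> H z"
        using walk_Suc_ge[OF assms(3), of n T A "y + n"] by (simp add: H_def y(1)[symmetric])
      moreover have "m - i < H (y + n)"
        using before[of "y + n"] y(1) by linarith
      ultimately show ?thesis
        using z by linarith
    qed
    then have "H (Suc (y + n)) = m - i"
      using y(1) by simp
    moreover have "m - i < H x" if "x \<le> y + n" for x
      using before[of x] that y(1) by linarith
    ultimately show ?thesis
      using y(2) by (intro exI[of _ y]) (simp add: gaps_def H_def)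
  qed
  then have "\<forall>i\<in>{1..g}. \<exists>y. y < n \<and> y \<in> gaps n \<delta> T A \<and> H (Suc (y + n)) = m - i"
    by blast
  from bchoice[OF this] obtain p
    where p: "\<forall>i\<in>{1..g}. p i < n \<and> p i \<in> gaps n \<delta> T A \<and> H (Suc (p i + n)) = m - i"
    by blast
  have "inj_on p {1..g}"
  proof (intro inj_onI)
    fix i j
    assume "i \<in> {1..g}" "j \<in> {1..g}" "p i = p j"
    then have "m - i = m - j"
      using p[rule_format, of i] p[rule_format, of j] by metis
    then show "i = j"
      by simp
  qed
  moreover have "p ` {1..g} \<subseteq> gaps n \<delta> T A"
    using p by blast
  moreover have "finite (gaps n \<delta> T A)"
    by (simp add: gaps_def)
  ultimately have "card {1..g} \<le> card (gaps n \<delta> T A)"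
    by (rule card_inj_on_le)
  then show ?thesis
    by (simp add: g_def)
qed

text \<open>
The key to disjointness. Suppose that \<open>C\<close> lies in both intervals although \<open>a \<in> A - A'\<close>. Then \<open>a\<close> is
a gap of \<open>A'\<close>. Start the walk of \<open>A\<close> at \<open>a\<close> and stop when it first returns to its initial height.
No gap of \<open>A\<close> occurs on this arc, so \<open>C\<close>, and with it \<open>A'\<close>, contains only elements of \<open>A\<close> there, and
\<open>A'\<close> misses \<open>a\<close>. If the arc has \<open>s\<close> elements of \<open>A\<close>, it has \<open>\<delta> s\<close> places of \<open>T\<close>, hence by the
comparison hypothesis at least \<open>\<delta>' s\<close> places of \<open>T'\<close>, whereas \<open>A'\<close> pays for only \<open>\<delta>' (s - 1)\<close> of
them. So the walk of \<open>A'\<close> loses at least \<open>\<delta>'\<close> on an arc that starts at a record low, which is more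
than the total loss of \<open>|T'| - \<delta>'|A'| < \<delta>'\<close> of a full turn: the next visit of \<open>a\<close> cannot be a record.
\<close>

lemma subset_if_intervals_meet:
  assumes sub: "C \<subseteq> {..<n}" "T \<subseteq> {..<n}" "T' \<subseteq> {..<n}"
    and A: "A \<subseteq> C" "C \<subseteq> A \<union> gaps n \<delta> T A"
    and A': "A' \<subseteq> C" "C \<subseteq> A' \<union> gaps n \<delta>' T' A'"
    and \<delta>: "1 \<le> \<delta>" "1 \<le> \<delta>'"
    and T: "\<delta> * int (card A) \<le> int (card T)" "int (card T') < \<delta>' * (int (card A') + 1)"
    and compare: "\<And>p q s. p \<le> q \<Longrightarrow> visits n T q - visits n T p = \<delta> * s \<Longrightarrow>
      \<delta>' * s \<le> visits n T' q - visits n T' p"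
  shows "A \<subseteq> A'"
proof
  fix a assume aA: "a \<in> A"
  show "a \<in> A'"
  proof (rule ccontr)
    assume aA': "a \<notin> A'"
    define H where "H = walk n \<delta> T A"
    define H' where "H' = walk n \<delta>' T' A'"
    have a_gap: "a \<in> gaps n \<delta>' T' A'"
      using aA aA' A A' by blast
    have "a < n"
      using a_gap by (simp add: gaps_def)
    have H_period: "H (y + n) = H y - (int (card T) - \<delta> * int (card A))" for y
      unfolding H_def using A(1) sub by (intro walk_add_period) auto
    have H'_period: "H' (y + n) = H' y - (int (card T') - \<delta>' * int (card A'))" for y
      unfolding H'_def using A'(1) sub by (intro walk_add_period) auto
    define p where "p = a + n"
    define q where "q = (LEAST y. p < y \<and> H y \<le> H p)"
    have "p < p + n \<and> H (p + n) \<le> H p"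
      using H_period[of p] T(1) \<open>a < n\<close> by simp
    then have q: "p < q" "H q \<le> H p" "q \<le> p + n"
      unfolding q_def
      using LeastI[of "\<lambda>y. p < y \<and> H y \<le> H p" "p + n"]
        Least_le[of "\<lambda>y. p < y \<and> H y \<le> H p" "p + n"] by blast+
    have between: "H p \<le> H y" if "p \<le> y" "y < q" for y
      using not_less_Least[of y "\<lambda>y. p < y \<and> H y \<le> H p"] that
      by (cases "y = p") (auto simp: q_def)
    have "H q = H p"
    proof -
      obtain r where r: "q = Suc r" "p \<le> r"
        using q(1) by (cases q) auto
      show ?thesis
      proof (cases "r = p")
        case True
        then have "H q \<ge> H p"
          using r aA \<delta>(1) \<open>a < n\<close> by (simp add: H_def walk_Suc p_def)
        then show ?thesis
          using q(2) by simp
      next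
        case False
        then have "H p < H r"
          using not_less_Least[of r "\<lambda>y. p < y \<and> H y \<le> H p"] r by (force simp: q_def)
        then show ?thesis
          using walk_Suc_ge[of \<delta> n T A r] \<delta>(1) r q(2) by (simp add: H_def)
      qed
    qed
    have no_gap: "x mod n \<notin> gaps n \<delta> T A" if "p \<le> x" "x < q" for x
    proof
      assume gap: "x mod n \<in> gaps n \<delta> T A"
      define y where "y = x mod n"
      have rec: "H (Suc (y + n)) < H z" if "z \<le> y + n" for z
        using gap that by (simp add: gaps_def H_def y_def)
      \<comment> \<open>The arc may run past the end of the second turn; then its record refers to the turn before.\<close>
      have "H (Suc x) < H p"
      proof (cases "x < n + n")
        case True
        then have "x = y + n"
          using \<open>p \<le> x\<close> by (simp add: y_def p_def le_mod_geq)
        then show ?thesis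
          using rec[of p] that by simp
      next
        case False
        have "x < n + n + n"
          using that q(3) \<open>a < n\<close> by (simp add: p_def)
        then have x: "x = y + n + n"
          using False by (simp add: y_def le_mod_geq)
        then have "a \<le> y + n"
          using \<open>a < n\<close> by simp
        then have "H (Suc (y + n)) < H a"
          by (rule rec)
        then show ?thesis
          using H_period[of a] H_period[of "Suc (y + n)"] x by (simp add: p_def)
      qed
      moreover have "H p \<le> H (Suc x)"
        using between[of "Suc x"] that \<open>H q = H p\<close> by (cases "Suc x = q") auto
      ultimately show False
        by simp
    qed
    \<comment> \<open>The count starts after \<open>a\<close>, where \<open>A\<close> has already gained one element over \<open>A'\<close>.\<close>
    have fewer: "visits n A' y - visits n A' p \<le> visits n A y - visits n A p - 1"
      if "Suc p \<le> y" "y \<le> q" for y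
      using that
    proof (induction y rule: dec_induct)
      case base
      then show ?case
        using aA aA' \<open>a < n\<close> by (simp add: visits_Suc p_def)
    next
      case (step y)
      have "y mod n \<in> A' \<Longrightarrow> y mod n \<in> A"
        using no_gap[of y] step A(2) A'(1) by auto
      then show ?case
        using step by (auto simp: visits_Suc)
    qed
    define s where "s = visits n A q - visits n A p"
    have "visits n T q - visits n T p = \<delta> * s"
      using \<open>H q = H p\<close> by (simp add: H_def walk_def s_def algebra_simps)
    then have "\<delta>' * s \<le> visits n T' q - visits n T' p"
      using q(1) by (intro compare) auto
    moreover have "\<delta>' * (visits n A' q - visits n A' p) \<le> \<delta>' * (s - 1)"
      using fewer[of q] q(1) \<delta>(2) by (intro mult_left_mono) (auto simp: s_def)
    ultimately have drop: "H' q \<le> H' p - \<delta>'"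
      by (simp add: H'_def walk_def algebra_simps)
    have "H' (Suc p) = H' p - 1"
      using gaps_steps_down[OF a_gap \<delta>(2)] \<open>a < n\<close> by (simp add: H'_def walk_Suc p_def)
    then have "H' p - 1 - (int (card T') - \<delta>' * int (card A')) = H' (Suc (p + n))"
      using H'_period[of "Suc p"] by simp
    also have "\<dots> < H' q"
    proof -
      have rec: "H' (Suc p) < H' x" if "x \<le> p" for x
        using a_gap that by (simp add: gaps_def H'_def p_def)
      show ?thesis
        using rec[of "q - n"] H'_period[of "q - n"] H'_period[of "Suc p"] q p_def by simp
    qed
    finally show False
      using drop T(2) by (simp add: algebra_simps)
  qed
qed

section \<open>Long intervals in the Boolean lattice\<close>

lemma visits_diff_mono:
  assumes "A \<subseteq> B" "p \<le> q"
  shows "visits n A q - visits n A p \<le> visits n B q - visits n B p"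
  using assms(2)
proof (induction q rule: dec_induct)
  case (step y)
  then show ?case
    using assms(1) by (auto simp: visits_Suc)
qed simp

text \<open>
Every \<open>(k + 1)\<close>-st of the first \<open>(k + 1)(d + 1) - 1\<close> places is removed, \<open>d\<close> places in all. The
\<open>k\<close> places after the last removed one make the spacing right also across the end of the circle.
\<close>

definition thinned :: "nat \<Rightarrow> nat \<Rightarrow> nat set" where
  "thinned k d = {x. x < (k + 1) * (d + 1) - 1 \<and> \<not> k + 1 dvd x + 1}"

text \<open>
The left-hand side gains \<open>1\<close> at a place that is kept and loses \<open>k\<close> at a removed one. So within a
turn it counts the places modulo \<open>k + 1\<close>, and every full turn leaves it higher by \<open>k\<close>.
\<close>

lemma visits_thinned:
  fixes k d n :: nat
  defines "N \<equiv> (k + 1) * (d + 1) - 1"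
  assumes "1 \<le> k" "N \<le> n"
  shows "(int k + 1) * visits n (thinned k d) y - int k * visits n {..<N} y
    = int k * int (y div n) + int (min (y mod n) N mod (k + 1))"
proof -
  have N: "Suc N = (k + 1) * (d + 1)"
    by (simp add: N_def)
  have "N mod (k + 1) = k"
  proof -
    have "N = k + (k + 1) * d"
      using N by simp
    then have "N mod (k + 1) = k mod (k + 1)"
      by (simp only: mod_mult_self2)
    then show ?thesis
      by simp
  qed
  have "0 < N"
    using assms(2) N by (cases N) auto
  then have "0 < n"
    using assms(3) by simp
  show ?thesis
  proof (induction y)
    case 0
    then show ?case
      by (simp add: visits_def)
  next
    case (Suc y)
    define r where "r = y mod n"
    have "r < n"
      using \<open>0 < n\<close> by (simp add: r_def)
    have thinned: "r \<in> thinned k d \<longleftrightarrow> r < N \<and> Suc (r mod (k + 1)) \<noteq> k + 1"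
    proof -
      have "k + 1 dvd r + 1 \<longleftrightarrow> Suc (r mod (k + 1)) = k + 1"
        by (simp add: dvd_eq_mod_eq_0 mod_Suc)
      then show ?thesis
        unfolding thinned_def N_def by blast
    qed
    have step: "(int k + 1) * visits n (thinned k d) (Suc y) - int k * visits n {..<N} (Suc y)
      = int k * int (y div n) + int (min r N mod (k + 1))
        + (int k + 1) * of_bool (r \<in> thinned k d) - int k * of_bool (r < N)"
      using Suc.IH by (simp add: visits_Suc r_def algebra_simps)
    also have "\<dots> = int k * int (y div n) + int (min (Suc r) N mod (k + 1))"
    proof (cases "r < N")
      case True
      then show ?thesis
        using thinned by (auto simp: mod_Suc min_def)
    next
      case False
      then show ?thesis
        using thinned by simp
    qed
    also have "\<dots> = int k * int (Suc y div n) + int (min (Suc y mod n) N mod (k + 1))"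
    proof (cases "Suc r = n")
      case True
      then have "Suc y mod n = 0" "Suc y div n = Suc (y div n)"
        by (simp_all add: r_def mod_Suc div_Suc)
      moreover have "min (Suc r) N = N"
        using True assms(3) by simp
      ultimately show ?thesis
        using \<open>N mod (k + 1) = k\<close> by (simp add: distrib_left)
    next
      case False
      then show ?thesis
        by (simp add: r_def mod_Suc div_Suc)
    qed
    finally show ?case .
  qed
qed

lemma thinned_subset: "thinned k d \<subseteq> {..<(k + 1) * (d + 1) - 1}"
  by (auto simp: thinned_def)

lemma card_thinned:
  assumes "1 \<le> k"
  shows "card (thinned k d) = k * (d + 1)"
proof -
  define N where "N = (k + 1) * (d + 1) - 1"
  have N: "int N = (int k + 1) * (int d + 1) - 1"
    by (simp add: N_def of_nat_diff algebra_simps)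
  have "0 < N"
    using assms by (auto simp: N_def)
  have "visits N (thinned k d) N = int (card (thinned k d))"
    using thinned_subset[of k d] by (intro visits_period) (simp add: N_def)
  moreover have "visits N {..<N} N = int N"
    by (subst visits_period) auto
  moreover have "(int k + 1) * visits N (thinned k d) N - int k * visits N {..<N} N
      = int k * int (N div N) + int (min (N mod N) N mod (k + 1))"
    unfolding N_def using assms by (rule visits_thinned) simp
  ultimately have "(int k + 1) * int (card (thinned k d)) - int k * int N = int k"
    using \<open>0 < N\<close> by simp
  then have "(int k + 1) * int (card (thinned k d)) = (int k + 1) * (int k * (int d + 1))"
    by (simp add: N algebra_simps)
  then have "int (card (thinned k d)) = int k * (int d + 1)"
    by (simp only: mult_cancel_left) auto
  then have "int (card (thinned k d)) = int (k * (d + 1))"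
    by (simp add: distrib_left)
  then show ?thesis
    by (simp only: of_nat_eq_iff)
qed

text \<open>
An arc with \<open>(k + 1) s\<close> of the original places keeps at least \<open>k s\<close> of them. Indeed
\<open>k + 1\<close> times the surplus is the difference of two values of the expression in \<open>visits_thinned\<close>,
which is at least \<open>- k\<close>; being a multiple of \<open>k + 1\<close>, it cannot be negative.
\<close>

lemma thinned_compare:
  fixes k d n :: nat
  defines "N \<equiv> (k + 1) * (d + 1) - 1"
  assumes "1 \<le> k" "N \<le> n" "p \<le> q"
    and s: "visits n {..<N} q - visits n {..<N} p = (int k + 1) * s"
  shows "int k * s \<le> visits n (thinned k d) q - visits n (thinned k d) p"
proof -
  define u where "u = visits n (thinned k d) q - visits n (thinned k d) p - int k * s"
  have "(int k + 1) * u = ((int k + 1) * visits n (thinned k d) q - int k * visits n {..<N} q)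
      - ((int k + 1) * visits n (thinned k d) p - int k * visits n {..<N} p)"
  proof -
    have "visits n {..<N} q = visits n {..<N} p + (int k + 1) * s"
      using s by simp
    then show ?thesis
      unfolding u_def by (simp add: algebra_simps)
  qed
  also have "\<dots> = int k * (int (q div n) - int (p div n))
      + int (min (q mod n) N mod (k + 1)) - int (min (p mod n) N mod (k + 1))"
    using visits_thinned[OF assms(2), of d n] assms(3) by (simp add: N_def algebra_simps)
  also have "\<dots> \<ge> - int k"
  proof -
    have "0 \<le> int k * (int (q div n) - int (p div n))"
      using div_le_mono[OF assms(4), of n] by simp
    moreover have "min (p mod n) N mod (k + 1) \<le> k"
      using mod_less_divisor[of "k + 1" "min (p mod n) N"] by linarith
    ultimately show ?thesis
      by linarith
  qed
  finally have "(int k + 1) * (- 1) < (int k + 1) * u"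
    by simp
  then have "- 1 < u"
    by (rule mult_left_less_imp_less) simp
  then show ?thesis
    by (simp add: u_def)
qed

text \<open>
Sets of size \<open>d\<close> use the weight \<open>k + 1\<close> and the first \<open>(k + 1)(d + 1) - 1\<close> places; a full turn
loses \<open>k\<close>, less than the weight. Sets of size \<open>d + j\<close> with \<open>0 < j < k\<close> use the weight \<open>k\<close> and
\<open>k (d + 1) + j (k - 1)\<close> places; a full turn loses \<open>k - j\<close>. These places extend the thinned set and
increase with \<open>j\<close>, which gives the comparison of arcs that disjointness needs. The two hypotheses
say that the circle has room for the place sets of \<open>j = 0\<close> and \<open>j = k - 1\<close>. Sets of size at least
\<open>d + k\<close> form intervals of their own.
\<close>

lemma long_intervals_exist:
  fixes n d k :: nat
  assumes n: "(k + 1) * (d + 1) \<le> n + 1" "k * (d + 1) + (k - 1)\<^sup>2 \<le> n"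
  obtains f :: "nat set \<Rightarrow> nat set" where
    "\<And>A. A \<subseteq> {..<n} \<Longrightarrow> A \<subseteq> f A \<and> f A \<subseteq> {..<n}"
    "\<And>A. A \<subseteq> {..<n} \<Longrightarrow> d \<le> card A \<Longrightarrow> d + k \<le> card (f A)"
    "\<And>A A' C. C \<subseteq> {..<n} \<Longrightarrow> A \<subseteq> C \<Longrightarrow> C \<subseteq> f A \<Longrightarrow> A' \<subseteq> C \<Longrightarrow> C \<subseteq> f A' \<Longrightarrow>
      d \<le> card A \<Longrightarrow> card A \<le> card A' \<Longrightarrow> A \<subseteq> A'"
proof -
  define N where "N = (k + 1) * (d + 1) - 1"
  have intN: "int N = (int k + 1) * (int d + 1) - 1"
    by (simp add: N_def of_nat_diff algebra_simps)
  have "N \<le> n"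
    using n(1) by (simp add: N_def)
  have thinned_n: "thinned k d \<subseteq> {..<n}"
    using thinned_subset[of k d] \<open>N \<le> n\<close> by (force simp: N_def)
  define m where "m = card ({..<n} - thinned k d)"
  obtain h where h: "bij_betw h {..<m} ({..<n} - thinned k d)"
    using ex_bij_betw_nat_finite[of "{..<n} - thinned k d"] by (auto simp: m_def atLeast0LessThan)
  define T where "T j = (if j = 0 then {..<N} else thinned k d \<union> h ` {..<j * (k - 1)})" for j
  define \<delta> where "\<delta> j = (if j = 0 then int k + 1 else int k)" for j :: nat
  define f where
    "f A = (if card A < d + k then A \<union> gaps n (\<delta> (card A - d)) (T (card A - d)) A else A)" for A
  have le_m: "j * (k - 1) \<le> m" if "j < k" for j
  proof -
    have "j * (k - 1) \<le> (k - 1)\<^sup>2"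
      using that by (auto simp: power2_eq_square)
    moreover have "m = n - k * (d + 1)"
      using that thinned_n card_thinned[of k d]
      by (simp add: m_def card_Diff_subset finite_subset[OF thinned_n])
    ultimately show ?thesis
      using n(2) by linarith
  qed
  have T_sub: "T j \<subseteq> {..<n}" if "j < k" for j
  proof -
    have "h ` {..<j * (k - 1)} \<subseteq> h ` {..<m}"
      using le_m[OF that] by (intro image_mono) auto
    also have "\<dots> \<subseteq> {..<n}"
      using h by (auto simp: bij_betw_def)
    finally show ?thesis
      using thinned_n \<open>N \<le> n\<close> by (auto simp: T_def)
  qed
  have card_T: "int (card (T j)) = \<delta> j * (int d + int j) + (int k - int j)" if "j < k" for j
  proof (cases "j = 0")
    case True
    then show ?thesis
      by (simp add: T_def \<delta>_def intN algebra_simps)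
  next
    case False
    have "card (h ` {..<j * (k - 1)}) = j * (k - 1)"
      using h le_m[OF that] by (subst card_image) (auto simp: bij_betw_def elim: inj_on_subset)
    moreover have "h ` {..<j * (k - 1)} \<inter> thinned k d = {}"
      using h le_m[OF that] by (fastforce simp: bij_betw_def)
    ultimately have "card (T j) = k * (d + 1) + j * (k - 1)"
      using False that card_thinned[of k d] finite_subset[OF thinned_n]
      by (simp add: T_def card_Un_disjoint Int_commute)
    then show ?thesis
      using False that by (simp add: \<delta>_def of_nat_diff right_diff_distrib distrib_left)
  qed
  have compare: "\<delta> j * s \<le> visits n (T j) q - visits n (T j) p"
    if "i \<le> j" "j < k" "p \<le> q" "visits n (T i) q - visits n (T i) p = \<delta> i * s" for i j p q s
  proof (cases "i = j")
    case True
    then show ?thesis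
      using that by simp
  next
    case False
    show ?thesis
    proof (cases "i = 0")
      case True
      have "int k * s \<le> visits n (thinned k d) q - visits n (thinned k d) p"
        using that True \<open>N \<le> n\<close> by (intro thinned_compare) (auto simp: T_def \<delta>_def N_def)
      also have "\<dots> \<le> visits n (T j) q - visits n (T j) p"
        using that False True by (intro visits_diff_mono) (auto simp: T_def)
      finally show ?thesis
        using False True by (simp add: \<delta>_def)
    next
      case False
      have "h ` {..<i * (k - 1)} \<subseteq> h ` {..<j * (k - 1)}"
        using that(1) by (intro image_mono) (auto intro: less_le_trans mult_le_mono1)
      then have "visits n (T i) q - visits n (T i) p \<le> visits n (T j) q - visits n (T j) p"
        using that False by (intro visits_diff_mono) (auto simp: T_def)
      then show ?thesis
        using that False by (simp add: \<delta>_def)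
    qed
  qed
  have f1: "A \<subseteq> f A \<and> f A \<subseteq> {..<n}" if "A \<subseteq> {..<n}" for A
    using that by (auto simp: f_def gaps_def)
  have f2: "d + k \<le> card (f A)" if A: "A \<subseteq> {..<n}" "d \<le> card A" for A
  proof (cases "card A < d + k")
    case True
    define j where "j = card A - d"
    have j: "j < k" "card A = d + j"
      using True A(2) by (auto simp: j_def)
    have pos: "1 \<le> \<delta> j"
      using j(1) by (simp add: \<delta>_def)
    have "int k - int j \<le> int (card (gaps n (\<delta> j) (T j) A))"
      using card_gaps_ge[OF A(1) T_sub[OF j(1)], of "\<delta> j"] card_T[OF j(1)] j(2) pos by simp
    moreover have "card (f A) = card A + card (gaps n (\<delta> j) (T j) A)"
      using True gaps_steps_down(1)[OF _ pos] finite_subset[OF A(1)]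
      by (auto simp: f_def j_def intro!: card_Un_disjoint simp: gaps_def)
    ultimately show ?thesis
      using j by linarith
  next
    case False
    then show ?thesis
      by (simp add: f_def)
  qed
  have f3: "A \<subseteq> A'"
    if C: "C \<subseteq> {..<n}" "A \<subseteq> C" "C \<subseteq> f A" "A' \<subseteq> C" "C \<subseteq> f A'"
      and "d \<le> card A" "card A \<le> card A'" for A A' C
  proof (cases "card A' < d + k")
    case True
    define i where "i = card A - d"
    define j where "j = card A' - d"
    have ij: "i \<le> j" "j < k" "card A = d + i" "card A' = d + j"
      using that True by (auto simp: i_def j_def)
    have "1 \<le> \<delta> i" "1 \<le> \<delta> j"
      using ij by (auto simp: \<delta>_def)
    moreover have "\<delta> i * int (card A) \<le> int (card (T i))"
      using card_T[of i] ij by simp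
    moreover have "int (card (T j)) < \<delta> j * (int (card A') + 1)"
    proof -
      have "int k - int j < \<delta> j"
        using ij by (simp add: \<delta>_def)
      then show ?thesis
        using card_T[of j] ij by (simp add: distrib_left)
    qed
    moreover have "C \<subseteq> A \<union> gaps n (\<delta> i) (T i) A" "C \<subseteq> A' \<union> gaps n (\<delta> j) (T j) A'"
      using that True by (auto simp: f_def i_def j_def split: if_splits)
    ultimately show ?thesis
      using subset_if_intervals_meet[of C n "T i" "T j" A "\<delta> i" A' "\<delta> j"]
        C T_sub[of i] T_sub[of j] ij compare[OF ij(1,2)] by auto
  next
    case False
    then have "A' = C"
      using C by (auto simp: f_def)
    then show ?thesis
      using C by simp
  qed
  show thesis
    using f1 f2 f3 by (rule that)
qed

section \<open>Interval partitions\<close>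

text \<open>
Going up by cardinality, a set not yet covered starts its own interval. By hypothesis this interval
could meet that of an earlier set \<open>A\<close> only if \<open>A\<close> were contained in the new set, which would then
have been covered already.
\<close>

lemma greedy_interval_partition:
  fixes f :: "'x::finite set \<Rightarrow> 'x set"
  assumes "\<And>A. A \<subseteq> f A"
    and meet: "\<And>A A' C. \<lbrakk>A \<subseteq> C; C \<subseteq> f A; A' \<subseteq> C; C \<subseteq> f A'; d \<le> card A; card A \<le> card A'\<rbrakk>
      \<Longrightarrow> A \<subseteq> A'"
  obtains F :: "'x set set" where "\<And>A. A \<in> F \<Longrightarrow> d \<le> card A"
    and "\<And>S. d \<le> card S \<Longrightarrow> \<exists>!A. A \<in> F \<and> A \<subseteq> S \<and> S \<subseteq> f A"
proof -
  have "\<exists>F. (\<forall>A\<in>F. d \<le> card A \<and> card A < d + m) \<and>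
      (\<forall>S. d \<le> card S \<longrightarrow> card S < d + m \<longrightarrow> (\<exists>A\<in>F. A \<subseteq> S \<and> S \<subseteq> f A)) \<and>
      (\<forall>A\<in>F. \<forall>A'\<in>F. \<forall>C. A \<subseteq> C \<and> C \<subseteq> f A \<and> A' \<subseteq> C \<and> C \<subseteq> f A' \<longrightarrow> A = A')" for m
  proof (induction m)
    case 0
    show ?case
      by (intro exI[of _ "{}"]) simp
  next
    case (Suc m)
    then obtain F where F: "\<forall>A\<in>F. d \<le> card A \<and> card A < d + m"
      "\<forall>S. d \<le> card S \<longrightarrow> card S < d + m \<longrightarrow> (\<exists>A\<in>F. A \<subseteq> S \<and> S \<subseteq> f A)"
      "\<forall>A\<in>F. \<forall>A'\<in>F. \<forall>C. A \<subseteq> C \<and> C \<subseteq> f A \<and> A' \<subseteq> C \<and> C \<subseteq> f A' \<longrightarrow> A = A'"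
      by (elim exE conjE) (rule that)
    define G where "G = {A. card A = d + m \<and> \<not> (\<exists>B\<in>F. B \<subseteq> A \<and> A \<subseteq> f B)}"
    have new: False if "A \<in> F" "A' \<in> G" "A \<subseteq> C" "C \<subseteq> f A" "A' \<subseteq> C" "C \<subseteq> f A'" for A A' C
    proof -
      have "d \<le> card A" "card A < d + m" "card A' = d + m"
        using that F(1) by (auto simp: G_def)
      then have "A \<subseteq> A'"
        using that by (intro meet[of A C A']) simp_all
      moreover have "A' \<subseteq> f A"
        using that by blast
      ultimately show False
        using that by (simp add: G_def)
    qed
    have both_new: "A = A'"
      if "A \<in> G" "A' \<in> G" "A \<subseteq> C" "C \<subseteq> f A" "A' \<subseteq> C" "C \<subseteq> f A'" for A A' C
    proof -
      have "card A = d + m" "card A' = d + m"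
        using that by (simp_all add: G_def)
      moreover from this have "A \<subseteq> A'"
        using that by (intro meet[of A C A']) simp_all
      ultimately show ?thesis
        by (intro card_subset_eq) simp_all
    qed
    show ?case
    proof (intro exI[of _ "F \<union> G"] conjI ballI allI impI)
      fix S :: "'x set"
      assume S: "d \<le> card S" "card S < d + Suc m"
      show "\<exists>A\<in>F \<union> G. A \<subseteq> S \<and> S \<subseteq> f A"
      proof (cases "card S < d + m")
        case True
        then show ?thesis
          using F(2)[rule_format, OF S(1) True] by blast
      next
        case False
        then have "card S = d + m"
          using S by simp
        then have "S \<in> G \<or> (\<exists>B\<in>F. B \<subseteq> S \<and> S \<subseteq> f B)"
          unfolding G_def by blast
        then show ?thesis
          using assms(1)[of S] by blast
      qed
    next
      fix A A' C
      assume "A \<in> F \<union> G" "A' \<in> F \<union> G" and C: "A \<subseteq> C \<and> C \<subseteq> f A \<and> A' \<subseteq> C \<and> C \<subseteq> f A'"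
      then consider "A \<in> F" "A' \<in> F" | "A \<in> F" "A' \<in> G" | "A \<in> G" "A' \<in> F" | "A \<in> G" "A' \<in> G"
        by blast
      then show "A = A'"
      proof cases
        case 1
        show ?thesis
          by (rule F(3)[rule_format, OF 1 C])
      next
        case 2
        then show ?thesis
          using new[of A A' C] C by simp
      next
        case 3
        then show ?thesis
          using new[of A' A C] C by simp
      next
        case 4
        then show ?thesis
          using both_new[of A A' C] C by simp
      qed
    next
      fix A
      assume "A \<in> F \<union> G"
      then show "d \<le> card A" "card A < d + Suc m"
        using F(1) by (auto simp: G_def)
    qed
  qed
  from this[of "Suc (card (UNIV :: 'x set))"] obtain F
    where F: "\<forall>A\<in>F. d \<le> card A \<and> card A < d + Suc (card (UNIV :: 'x set))"
      "\<forall>S. d \<le> card S \<longrightarrow> card S < d + Suc (card (UNIV :: 'x set)) \<longrightarrow>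
        (\<exists>A\<in>F. A \<subseteq> S \<and> S \<subseteq> f A)"
      "\<forall>A\<in>F. \<forall>A'\<in>F. \<forall>C. A \<subseteq> C \<and> C \<subseteq> f A \<and> A' \<subseteq> C \<and> C \<subseteq> f A' \<longrightarrow> A = A'"
    by (elim exE conjE) (rule that)
  show thesis
  proof (rule that[of F])
    fix S :: "'x set"
    assume "d \<le> card S"
    moreover have "card S < d + Suc (card (UNIV :: 'x set))"
      using card_mono[of UNIV S] by simp
    ultimately obtain A where A: "A \<in> F" "A \<subseteq> S" "S \<subseteq> f A"
      using F(2) by auto
    show "\<exists>!A. A \<in> F \<and> A \<subseteq> S \<and> S \<subseteq> f A"
    proof (rule ex1I[of _ A])
      show "A \<in> F \<and> A \<subseteq> S \<and> S \<subseteq> f A"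
        using A by simp
      show "B = A" if "B \<in> F \<and> B \<subseteq> S \<and> S \<subseteq> f B" for B
        by (rule F(3)[rule_format, of B A S]) (use A that in blast)+
    qed
  qed (use F(1) in blast)
qed

lemma interval_partition:
  fixes d k :: nat
  assumes "(k + 1) * (d + 1) \<le> CARD('x::finite) + 1" "k * (d + 1) + (k - 1)\<^sup>2 \<le> CARD('x)"
  obtains F :: "'x::finite set set" and f :: "'x set \<Rightarrow> 'x set"
  where "\<And>A. A \<in> F \<Longrightarrow> d \<le> card A" "\<And>A. A \<subseteq> f A"
    and "\<And>A. A \<in> F \<Longrightarrow> d + k \<le> card (f A)"
    and "\<And>S. d \<le> card S \<Longrightarrow> \<exists>!A. A \<in> F \<and> A \<subseteq> S \<and> S \<subseteq> f A"
proof -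
  obtain h where h: "bij_betw h (UNIV :: 'x set) {..<CARD('x)}"
    using ex_bij_betw_finite_nat[of "UNIV :: 'x set"] by (auto simp: atLeast0LessThan)
  then have inj: "inj h" and h_range: "range h = {..<CARD('x)}"
    by (auto simp: bij_betw_def)
  have h_in: "h ` A \<subseteq> {..<CARD('x)}" for A
    using h_range by blast
  have card_h: "card (h ` A) = card A" for A
    by (intro card_image inj_on_subset[OF inj]) auto
  show thesis
  proof (rule long_intervals_exist[OF assms])
    fix f
    assume f: "\<And>A. A \<subseteq> {..<CARD('x)} \<Longrightarrow> A \<subseteq> f A \<and> f A \<subseteq> {..<CARD('x)}"
      "\<And>A. A \<subseteq> {..<CARD('x)} \<Longrightarrow> d \<le> card A \<Longrightarrow> d + k \<le> card (f A)"
      "\<And>A A' C. C \<subseteq> {..<CARD('x)} \<Longrightarrow> A \<subseteq> C \<Longrightarrow> C \<subseteq> f A \<Longrightarrow> A' \<subseteq> C \<Longrightarrow> C \<subseteq> f A' \<Longrightarrow>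
        d \<le> card A \<Longrightarrow> card A \<le> card A' \<Longrightarrow> A \<subseteq> A'"
    define e where "e A = h -` f (h ` A)" for A
    have sub_e: "C \<subseteq> e A \<longleftrightarrow> h ` C \<subseteq> f (h ` A)" for A C
      by (auto simp: e_def)
    have A_e: "A \<subseteq> e A" for A
      using f(1)[OF h_in] sub_e by blast
    have "h ` e A = f (h ` A)" for A
      unfolding e_def using f(1)[OF h_in, of A] h_range by (simp add: image_vimage_eq Int_absorb2)
    then have card_e: "card (e A) = card (f (h ` A))" for A
      using card_h[of "e A"] by simp
    have meet: "A \<subseteq> A'"
      if "A \<subseteq> C" "C \<subseteq> e A" "A' \<subseteq> C" "C \<subseteq> e A'" "d \<le> card A" "card A \<le> card A'" for A A' C
    proof -
      have "h ` A \<subseteq> h ` A'"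
        by (rule f(3)[OF h_in[of C]]) (use that in \<open>simp_all add: sub_e card_h image_mono\<close>)
      then show ?thesis
        using inj by (simp add: inj_image_subset_iff)
    qed
    show thesis
    proof (rule greedy_interval_partition[of e d, OF A_e meet])
      fix F
      assume F: "\<And>A. A \<in> F \<Longrightarrow> d \<le> card A"
        "\<And>S. d \<le> card S \<Longrightarrow> \<exists>!A. A \<in> F \<and> A \<subseteq> S \<and> S \<subseteq> e A"
      have long: "d + k \<le> card (e A)" if "A \<in> F" for A
        using f(2)[OF h_in, of A] F(1)[OF that] by (simp add: card_e card_h)
      show thesis
        by (rule that[of F e, OF F(1) A_e long F(2)])
    qed
  qed
qed

section \<open>Monomials of the squarefree Veronese ideal\<close>

lemma module_mult: "module ((*) :: 'a::comm_ring_1 \<Rightarrow> 'a \<Rightarrow> 'a)"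
  by unfold_locales (simp_all add: algebra_simps)

lemma keys_add_nat: "Poly_Mapping.keys (s + t) = Poly_Mapping.keys s \<union> Poly_Mapping.keys t"
  for s t :: "'x \<Rightarrow>\<^sub>0 nat"
  by (auto simp: in_keys_iff lookup_add)

lemma poly_mapping_eq_sum_single:
  "f = (\<Sum>t\<in>Poly_Mapping.keys f. Poly_Mapping.single t (Poly_Mapping.lookup f t))"
proof (rule poly_mapping_eqI)
  fix k
  have "(\<Sum>t\<in>Poly_Mapping.keys f. Poly_Mapping.lookup (Poly_Mapping.single t (Poly_Mapping.lookup f t)) k)
      = (\<Sum>t\<in>Poly_Mapping.keys f. if t = k then Poly_Mapping.lookup f k else 0)"
    by (intro sum.cong) (auto simp: lookup_single when_def)
  then show "Poly_Mapping.lookup f k = Poly_Mapping.lookup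
      (\<Sum>t\<in>Poly_Mapping.keys f. Poly_Mapping.single t (Poly_Mapping.lookup f t)) k"
    by (auto simp: lookup_sum in_keys_iff)
qed

definition sqfree_exp :: "'x::finite set \<Rightarrow> 'x \<Rightarrow>\<^sub>0 nat" where
  "sqfree_exp A = Abs_poly_mapping (\<lambda>i. of_bool (i \<in> A))"

lemma lookup_sqfree_exp: "Poly_Mapping.lookup (sqfree_exp A) i = of_bool (i \<in> A)"
  by (simp add: sqfree_exp_def)

lemma keys_sqfree_exp [simp]: "Poly_Mapping.keys (sqfree_exp A) = A"
  by (auto simp: in_keys_iff lookup_sqfree_exp)

lemma exp_eq_sqfree_exp_add:
  fixes t :: "'x::finite \<Rightarrow>\<^sub>0 nat"
  assumes "A \<subseteq> Poly_Mapping.keys t"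
  obtains s where "t = s + sqfree_exp A"
    "Poly_Mapping.keys t = Poly_Mapping.keys s \<union> A"
proof
  let ?s = "Abs_poly_mapping (\<lambda>i. Poly_Mapping.lookup t i - of_bool (i \<in> A))"
  show eq: "t = ?s + sqfree_exp A"
  proof (rule poly_mapping_eqI)
    fix i
    show "Poly_Mapping.lookup t i = Poly_Mapping.lookup (?s + sqfree_exp A) i"
      using assms by (cases "i \<in> A") (auto simp: lookup_add lookup_sqfree_exp in_keys_iff)
  qed
  show "Poly_Mapping.keys t = Poly_Mapping.keys ?s \<union> A"
    by (subst eq) (simp add: keys_add_nat)
qed

lemma squarefree_monomials_eq:
  "squarefree_monomials d =
    (\<lambda>A. Poly_Mapping.single (sqfree_exp A) (1::'k::field)) ` {A :: 'x::finite set. card A = d}"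
proof -
  have eq: "(\<forall>i. Poly_Mapping.lookup t i \<le> 1) \<and> (\<Sum>i\<in>UNIV. Poly_Mapping.lookup t i) = d \<longleftrightarrow>
      (\<exists>A. card A = d \<and> t = sqfree_exp A)" for t :: "'x \<Rightarrow>\<^sub>0 nat"
  proof (intro iffI; elim conjE exE)
    assume t: "\<forall>i. Poly_Mapping.lookup t i \<le> 1" "(\<Sum>i\<in>UNIV. Poly_Mapping.lookup t i) = d"
    define A where "A = Poly_Mapping.keys t"
    have eq: "Poly_Mapping.lookup t i = of_bool (i \<in> A)" for i
      using t(1)[rule_format, of i] by (auto simp: A_def in_keys_iff)
    then have "t = sqfree_exp A"
      by (intro poly_mapping_eqI) (simp add: lookup_sqfree_exp)
    moreover have "card A = d"
      using t(2) by (simp add: eq)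
    ultimately show "\<exists>A. card A = d \<and> t = sqfree_exp A"
      by blast
  next
    fix A
    assume "card A = d" "t = sqfree_exp A"
    then show "(\<forall>i. Poly_Mapping.lookup t i \<le> 1) \<and> (\<Sum>i\<in>UNIV. Poly_Mapping.lookup t i) = d"
      by (simp add: lookup_sqfree_exp)
  qed
  show ?thesis
    unfolding squarefree_monomials_def eq by blast
qed

text \<open>
An ideal generated by monomials is spanned by the monomials divisible by one of its generators, and
a product of \<open>d\<close> distinct variables divides a monomial with at least \<open>d\<close> variables in its support.
\<close>

lemma squarefree_veronese_ideal_eq:
  "squarefree_veronese_ideal d =
    {f :: ('x::finite, 'k::field) mpolynomial. \<forall>t\<in>Poly_Mapping.keys f. d \<le> card (Poly_Mapping.keys t)}"
proof -
  interpret module "(*) :: ('x, 'k) mpolynomial \<Rightarrow> _"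
    by (rule module_mult)
  let ?G = "squarefree_monomials d :: ('x, 'k) mpolynomial set"
  let ?I = "{f :: ('x, 'k) mpolynomial. \<forall>t\<in>Poly_Mapping.keys f. d \<le> card (Poly_Mapping.keys t)}"
  have "span ?G = ?I"
  proof (rule span_subspace)
    show "?G \<subseteq> ?I"
      by (auto simp: squarefree_monomials_eq)
    show "subspace ?I"
    proof (rule subspaceI)
      fix f g :: "('x, 'k) mpolynomial"
      assume "f \<in> ?I" "g \<in> ?I"
      then show "f + g \<in> ?I"
        using keys_add[of f g] by auto
    next
      fix c f :: "('x, 'k) mpolynomial"
      assume f: "f \<in> ?I"
      show "c * f \<in> ?I"
      proof (intro CollectI ballI)
        fix t
        assume "t \<in> Poly_Mapping.keys (c * f)"
        then obtain r s where t: "t = r + s" "s \<in> Poly_Mapping.keys f"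
          using keys_mult[of c f] by blast
        then have "d \<le> card (Poly_Mapping.keys s)"
          using f by simp
        also have "\<dots> \<le> card (Poly_Mapping.keys t)"
          by (intro card_mono) (simp_all add: t keys_add_nat)
        finally show "d \<le> card (Poly_Mapping.keys t)" .
      qed
    qed simp
    show "?I \<subseteq> span ?G"
    proof
      fix f
      assume f: "f \<in> ?I"
      have "Poly_Mapping.single t (Poly_Mapping.lookup f t) \<in> span ?G" if "t \<in> Poly_Mapping.keys f" for t
      proof -
        have "d \<le> card (Poly_Mapping.keys t)"
          using f that by simp
        then obtain A where A: "A \<subseteq> Poly_Mapping.keys t" "card A = d"
          by (meson obtain_subset_with_card_n)
        obtain s where "t = s + sqfree_exp A"
          using A(1) by (rule exp_eq_sqfree_exp_add)
        then have "Poly_Mapping.single t (Poly_Mapping.lookup f t)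
            = Poly_Mapping.single s (Poly_Mapping.lookup f t) * Poly_Mapping.single (sqfree_exp A) 1"
          by (simp add: mult_single)
        also have "\<dots> \<in> span ?G"
          using A(2) by (intro span_scale span_base) (auto simp: squarefree_monomials_eq)
        finally show ?thesis .
      qed
      then have "(\<Sum>t\<in>Poly_Mapping.keys f. Poly_Mapping.single t (Poly_Mapping.lookup f t)) \<in> span ?G"
        by (rule span_sum)
      then show "f \<in> span ?G"
        by (simp flip: poly_mapping_eq_sum_single)
    qed
  qed
  then show ?thesis
    by (simp add: squarefree_veronese_ideal_def)
qed

lemma stanley_space_sqfree:
  fixes A B :: "'x::finite set"
  assumes "A \<subseteq> B"
  shows "stanley_space (*) (Poly_Mapping.single (sqfree_exp A) (1::'k::field)) B
    = {f. \<forall>t\<in>Poly_Mapping.keys f. A \<subseteq> Poly_Mapping.keys t \<and> Poly_Mapping.keys t \<subseteq> B}"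
    (is "?L = ?R")
proof
  show "?L \<subseteq> ?R"
  proof
    fix g
    assume "g \<in> ?L"
    then obtain f :: "('x, 'k) mpolynomial"
      where f: "\<forall>t\<in>Poly_Mapping.keys f. Poly_Mapping.keys t \<subseteq> B"
      and g: "g = f * Poly_Mapping.single (sqfree_exp A) 1"
      by (auto simp: stanley_space_def polys_in_def)
    show "g \<in> ?R"
    proof (intro CollectI ballI)
      fix t
      assume "t \<in> Poly_Mapping.keys g"
      then obtain s where "t = s + sqfree_exp A" "s \<in> Poly_Mapping.keys f"
        using keys_mult[of f "Poly_Mapping.single (sqfree_exp A) 1"] by (auto simp: g)
      then show "A \<subseteq> Poly_Mapping.keys t \<and> Poly_Mapping.keys t \<subseteq> B"
        using f assms by (auto simp: keys_add_nat)
    qed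
  qed
  show "?R \<subseteq> ?L"
  proof
    fix g :: "('x, 'k) mpolynomial"
    assume g: "g \<in> ?R"
    have "\<forall>t\<in>Poly_Mapping.keys g. \<exists>s. t = s + sqfree_exp A \<and> Poly_Mapping.keys s \<subseteq> B"
    proof
      fix t
      assume "t \<in> Poly_Mapping.keys g"
      then have t: "A \<subseteq> Poly_Mapping.keys t" "Poly_Mapping.keys t \<subseteq> B"
        using g by auto
      from t(1) obtain s where "t = s + sqfree_exp A" "Poly_Mapping.keys t = Poly_Mapping.keys s \<union> A"
        by (rule exp_eq_sqfree_exp_add)
      then show "\<exists>s. t = s + sqfree_exp A \<and> Poly_Mapping.keys s \<subseteq> B"
        using t(2) by blast
    qed
    from bchoice[OF this] obtain \<sigma> where
      \<sigma>: "\<forall>t\<in>Poly_Mapping.keys g. t = \<sigma> t + sqfree_exp A \<and> Poly_Mapping.keys (\<sigma> t) \<subseteq> B"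
      by blast
    define f where "f = (\<Sum>t\<in>Poly_Mapping.keys g. Poly_Mapping.single (\<sigma> t) (Poly_Mapping.lookup g t))"
    have "f * Poly_Mapping.single (sqfree_exp A) 1
        = (\<Sum>t\<in>Poly_Mapping.keys g. Poly_Mapping.single t (Poly_Mapping.lookup g t))"
      unfolding f_def sum_distrib_right
      by (intro sum.cong refl) (use \<sigma> in \<open>simp add: mult_single\<close>)
    then have "g = f * Poly_Mapping.single (sqfree_exp A) 1"
      by (simp flip: poly_mapping_eq_sum_single)
    moreover have "f \<in> polys_in B"
      using keys_sum[of "\<lambda>t. Poly_Mapping.single (\<sigma> t) (Poly_Mapping.lookup g t)" "Poly_Mapping.keys g"] \<sigma>
      by (fastforce simp: polys_in_def f_def split: if_splits)
    ultimately show "g \<in> ?L"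
      by (auto simp: stanley_space_def)
  qed
qed

definition restrict_keys :: "'a set \<Rightarrow> ('a \<Rightarrow>\<^sub>0 'b::zero) \<Rightarrow> 'a \<Rightarrow>\<^sub>0 'b" where
  "restrict_keys K f = Abs_poly_mapping (\<lambda>t. Poly_Mapping.lookup f t when t \<in> K)"

lemma lookup_restrict_keys:
  "Poly_Mapping.lookup (restrict_keys K f) t = (Poly_Mapping.lookup f t when t \<in> K)"
proof -
  have "finite {t. (Poly_Mapping.lookup f t when t \<in> K) \<noteq> 0}"
    by (rule finite_subset[OF _ finite_keys[of f]]) (auto simp: in_keys_iff)
  then show ?thesis
    by (simp add: restrict_keys_def)
qed

section \<open>Stanley decompositions\<close>

text \<open>
Any partition of a set of monomials splits the vector space they span into coordinate subspaces.
\<close>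

lemma is_direct_sum_keys_partition:
  fixes K :: "'i \<Rightarrow> 'a set"
  assumes "finite J"
    and P: "\<And>t. P t \<Longrightarrow> \<exists>!i. i \<in> J \<and> t \<in> K i" "\<And>i t. i \<in> J \<Longrightarrow> t \<in> K i \<Longrightarrow> P t"
  shows "is_direct_sum {f :: 'a \<Rightarrow>\<^sub>0 'b::ab_group_add. \<forall>t\<in>Poly_Mapping.keys f. P t} J
    (\<lambda>i. {f. Poly_Mapping.keys f \<subseteq> K i})"
proof -
  let ?V = "\<lambda>i. {f :: 'a \<Rightarrow>\<^sub>0 'b. Poly_Mapping.keys f \<subseteq> K i}"
  have other: "Poly_Mapping.lookup (v j) t = 0"
    if "v \<in> Pi\<^sub>E J ?V" "i \<in> J" "j \<in> J" "t \<in> K i" "j \<noteq> i" for v i j t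
    using that P by (metis (no_types, lifting) PiE_mem in_keys_iff mem_Collect_eq subsetD)
  have lookup_sum_v: "Poly_Mapping.lookup (\<Sum>j\<in>J. v j) t = Poly_Mapping.lookup (v i) t"
    if "v \<in> Pi\<^sub>E J ?V" "i \<in> J" "t \<in> K i" for v i t
  proof -
    have "(\<Sum>j\<in>J. Poly_Mapping.lookup (v j) t) = (\<Sum>j\<in>{i}. Poly_Mapping.lookup (v j) t)"
      using assms(1) that other[OF that(1,2) _ that(3)] by (intro sum.mono_neutral_right) auto
    then show ?thesis
      by (simp add: lookup_sum)
  qed
  have v_zero: "Poly_Mapping.lookup (v i) t = 0" if "v \<in> Pi\<^sub>E J ?V" "i \<in> J" "t \<notin> K i" for v i t
    using PiE_mem[OF that(1,2)] that(3) by (auto simp: in_keys_iff)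
  show ?thesis
    unfolding is_direct_sum_def
  proof (rule bij_betwI')
    fix v w
    assume v: "v \<in> Pi\<^sub>E J ?V" and w: "w \<in> Pi\<^sub>E J ?V"
    show "(\<Sum>i\<in>J. v i) = (\<Sum>i\<in>J. w i) \<longleftrightarrow> v = w"
    proof
      assume eq: "(\<Sum>i\<in>J. v i) = (\<Sum>i\<in>J. w i)"
      show "v = w"
      proof (rule PiE_ext[OF v w])
        fix i
        assume i: "i \<in> J"
        show "v i = w i"
        proof (rule poly_mapping_eqI)
          fix t
          show "Poly_Mapping.lookup (v i) t = Poly_Mapping.lookup (w i) t"
          proof (cases "t \<in> K i")
            case True
            then show ?thesis
              using lookup_sum_v[OF v i] lookup_sum_v[OF w i] eq by simp
          next
            case False
            then show ?thesis
              using v_zero[OF v i] v_zero[OF w i] by simp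
          qed
        qed
      qed
    qed simp
  next
    fix v
    assume v: "v \<in> Pi\<^sub>E J ?V"
    have "P t" if t: "t \<in> Poly_Mapping.keys (\<Sum>i\<in>J. v i)" for t
    proof -
      obtain i where "i \<in> J" "t \<in> Poly_Mapping.keys (v i)"
        using t keys_sum[of v J] by auto
      then show ?thesis
        using P(2) PiE_mem[OF v] by blast
    qed
    then show "(\<Sum>i\<in>J. v i) \<in> {f. \<forall>t\<in>Poly_Mapping.keys f. P t}"
      by simp
  next
    fix f :: "'a \<Rightarrow>\<^sub>0 'b"
    assume f: "f \<in> {f. \<forall>t\<in>Poly_Mapping.keys f. P t}"
    define v where "v = (\<lambda>i\<in>J. restrict_keys (K i) f)"
    have v: "v \<in> Pi\<^sub>E J ?V"
      by (auto simp: v_def in_keys_iff lookup_restrict_keys when_def split: if_splits)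
    have "f = (\<Sum>i\<in>J. v i)"
    proof (rule poly_mapping_eqI)
      fix t
      show "Poly_Mapping.lookup f t = Poly_Mapping.lookup (\<Sum>i\<in>J. v i) t"
      proof (cases "\<exists>i\<in>J. t \<in> K i")
        case True
        then obtain i where i: "i \<in> J" "t \<in> K i"
          by blast
        then show ?thesis
          using lookup_sum_v[OF v i] by (simp add: v_def lookup_restrict_keys)
      next
        case False
        then have "t \<notin> Poly_Mapping.keys f"
          using f P(1) by blast
        moreover have "(\<Sum>i\<in>J. Poly_Mapping.lookup (v i) t) = 0"
          using False v_zero[OF v] by (intro sum.neutral) auto
        ultimately show ?thesis
          by (simp add: in_keys_iff lookup_sum)
      qed
    qed
    then show "\<exists>v\<in>Pi\<^sub>E J ?V. f = (\<Sum>i\<in>J. v i)"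
      using v by blast
  qed
qed

text \<open>
Write \<open>x\<^sub>A\<close> for the product of the variables in \<open>A\<close>. A monomial with support \<open>S\<close> belongs to
\<open>x\<^sub>A K[f A]\<close> if and only if \<open>A \<subseteq> S \<subseteq> f A\<close>, so a partition of the possible supports into intervals
is a partition of the monomials of the ideal.
\<close>

lemma stanley_decomposition_of_interval_partition:
  fixes F :: "'x::finite set set"
  assumes F: "\<And>A. A \<in> F \<Longrightarrow> d \<le> card A" and f: "\<And>A. A \<subseteq> f A"
    and part: "\<And>S. d \<le> card S \<Longrightarrow> \<exists>!A. A \<in> F \<and> A \<subseteq> S \<and> S \<subseteq> f A"
  obtains m u Z where
    "stanley_decomposition (*) multidegree_component
      (squarefree_veronese_ideal d :: ('x, 'k::field) mpolynomial set) m u Z"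
    "\<And>i. i \<in> {1..m} \<Longrightarrow> \<exists>A\<in>F. Z i = f A"
proof -
  define m where "m = card F"
  obtain e where e: "bij_betw e {1..m} F"
    using ex_bij_betw_nat_finite_1[of F] by (auto simp: m_def)
  have eF: "e i \<in> F" if "i \<in> {1..m}" for i
    using e that by (auto simp: bij_betw_def)
  define u where "u i = Poly_Mapping.single (sqfree_exp (e i)) (1::'k)" for i
  define K :: "nat \<Rightarrow> ('x \<Rightarrow>\<^sub>0 nat) set" where
    "K i = {t. e i \<subseteq> Poly_Mapping.keys t \<and> Poly_Mapping.keys t \<subseteq> f (e i)}" for i
  have space: "stanley_space (*) (u i) (f (e i)) = {g. Poly_Mapping.keys g \<subseteq> K i}" for i
    unfolding u_def stanley_space_sqfree[OF f] K_def by blast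
  have "is_direct_sum {g :: ('x, 'k) mpolynomial. \<forall>t\<in>Poly_Mapping.keys g. d \<le> card (Poly_Mapping.keys t)}
    {1..m} (\<lambda>i. {g. Poly_Mapping.keys g \<subseteq> K i})"
  proof (rule is_direct_sum_keys_partition)
    fix t :: "'x \<Rightarrow>\<^sub>0 nat"
    assume "d \<le> card (Poly_Mapping.keys t)"
    from part[OF this] obtain A
      where A: "A \<in> F \<and> A \<subseteq> Poly_Mapping.keys t \<and> Poly_Mapping.keys t \<subseteq> f A"
        and uniq: "\<forall>B. B \<in> F \<and> B \<subseteq> Poly_Mapping.keys t \<and> Poly_Mapping.keys t \<subseteq> f B \<longrightarrow> B = A"
      by (rule ex1E)
    obtain i where i: "i \<in> {1..m}" "e i = A"
      using e A by (auto simp: bij_betw_def)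
    show "\<exists>!i. i \<in> {1..m} \<and> t \<in> K i"
    proof (rule ex1I[of _ i])
      show "i \<in> {1..m} \<and> t \<in> K i"
        using i A by (simp add: K_def)
      fix j
      assume j: "j \<in> {1..m} \<and> t \<in> K j"
      then have "e j = e i"
        using uniq[rule_format, of "e j"] eF[of j] i by (simp add: K_def)
      then show "j = i"
        using e i j by (auto simp: bij_betw_def dest: inj_onD)
    qed
  next
    fix i :: nat and t :: "'x \<Rightarrow>\<^sub>0 nat"
    assume "i \<in> {1..m}" "t \<in> K i"
    then have "d \<le> card (e i)" "e i \<subseteq> Poly_Mapping.keys t"
      using F[OF eF] by (auto simp: K_def)
    then show "d \<le> card (Poly_Mapping.keys t)"
      using card_mono[of "Poly_Mapping.keys t" "e i"] by simp
  qed simp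
  then have "is_direct_sum (squarefree_veronese_ideal d :: ('x, 'k) mpolynomial set) {1..m}
      (\<lambda>i. stanley_space (*) (u i) (f (e i)))"
    unfolding space squarefree_veronese_ideal_eq .
  moreover have "u i \<in> squarefree_veronese_ideal d" if "i \<in> {1..m}" for i
    using F[OF eF[OF that]] by (simp add: squarefree_veronese_ideal_eq u_def)
  moreover have "u i \<in> multidegree_component (\<lambda>j. int (Poly_Mapping.lookup (sqfree_exp (e i)) j))" for i
    by (simp add: multidegree_component_def u_def)
  ultimately have "stanley_decomposition (*) multidegree_component
      (squarefree_veronese_ideal d :: ('x, 'k) mpolynomial set) m u (\<lambda>i. f (e i))"
    unfolding stanley_decomposition_def by blast
  then show thesis
    by (rule that) (use eF in blast)
qed

lemma is_direct_sum_Int_zero: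
  assumes "is_direct_sum M J V" "finite J" "\<And>l. l \<in> J \<Longrightarrow> 0 \<in> V l"
    and "i \<in> J" "j \<in> J" "i \<noteq> j" "g \<in> V i" "g \<in> V j"
  shows "g = 0"
proof -
  define v where "v l = (\<lambda>l'\<in>J. if l' = l then g else 0)" for l
  have v: "v l \<in> Pi\<^sub>E J V" if "g \<in> V l" for l
    using assms(3) that by (auto simp: v_def)
  have "(\<Sum>l'\<in>J. v l l') = g" if "l \<in> J" for l
    using that assms(2) by (simp add: v_def)
  then have "(\<Sum>l'\<in>J. v i l') = (\<Sum>l'\<in>J. v j l')"
    using assms(4,5) by simp
  moreover have "inj_on (\<lambda>v. \<Sum>i\<in>J. v i) (Pi\<^sub>E J V)"
    using assms(1) by (simp add: is_direct_sum_def bij_betw_def)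
  ultimately have "v i = v j"
    using v[OF assms(7)] v[OF assms(8)] by (auto dest: inj_onD)
  then have "v i i = v j i"
    by simp
  then show ?thesis
    using assms(4,6) by (simp add: v_def)
qed

lemma card_subsets_of_type: "card {A :: 'x::finite set. card A = d} = CARD('x) choose d"
  using n_subsets[of "UNIV :: 'x set" d] by simp

text \<open>
For \<open>|A| = d\<close> the monomial \<open>x\<^sub>A\<close> has minimal degree in the ideal, so a summand that contributes to
it is generated by a multiple of \<open>x\<^sub>A\<close> itself. Its set \<open>Z\<close> has at least \<open>k\<close> elements \<open>j\<close> outside \<open>A\<close>,
and all \<open>x\<^sub>A x\<^sub>j\<close> lie in the summand. Since distinct summands intersect trivially, these are
distinct squarefree monomials of degree \<open>d + 1\<close> for all pairs \<open>(A, j)\<close>.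
\<close>

lemma stanley_decomposition_binomial_bound:
  fixes u :: "nat \<Rightarrow> ('x::finite, 'k::field) mpolynomial"
  assumes sd: "stanley_decomposition (*) multidegree_component (squarefree_veronese_ideal d) m u Z"
    and large: "\<And>i. i \<in> {1..m} \<Longrightarrow> d + k \<le> card (Z i)"
  shows "k * (CARD('x) choose d) \<le> CARD('x) choose (d + 1)"
proof -
  define V where "V = (\<lambda>i. stanley_space (*) (u i) (Z i))"
  let ?I = "squarefree_veronese_ideal d :: ('x, 'k) mpolynomial set"
  let ?J = "{1..m}"
  have ds: "is_direct_sum ?I ?J V"
    using sd by (simp add: stanley_decomposition_def V_def)
  have u_in: "u i \<in> ?I" if "i \<in> ?J" for i
    using sd that by (simp add: stanley_decomposition_def)
  have one_key: "t = t'"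
    if i: "i \<in> ?J" and t: "t \<in> Poly_Mapping.keys (u i)" "t' \<in> Poly_Mapping.keys (u i)" for i t t'
  proof -
    obtain a where "u i \<in> multidegree_component a"
      using sd i unfolding stanley_decomposition_def by blast
    then have "int (Poly_Mapping.lookup t l) = int (Poly_Mapping.lookup t' l)" for l
      using t by (simp add: multidegree_component_def)
    then show ?thesis
      by (intro poly_mapping_eqI) simp
  qed
  have generator: "\<exists>i c. i \<in> ?J \<and> c \<noteq> 0 \<and> u i = Poly_Mapping.single (sqfree_exp A) c"
    if A: "card A = d" for A
  proof -
    have "Poly_Mapping.single (sqfree_exp A) 1 \<in> ?I"
      using A by (simp add: squarefree_veronese_ideal_eq)
    then obtain v where v: "v \<in> Pi\<^sub>E ?J V" "Poly_Mapping.single (sqfree_exp A) 1 = (\<Sum>i\<in>?J. v i)"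
      using ds by (auto simp: is_direct_sum_def bij_betw_def image_iff set_eq_iff)
    have "sqfree_exp A \<in> Poly_Mapping.keys (\<Sum>i\<in>?J. v i)"
      unfolding v(2)[symmetric] by simp
    then obtain i where i: "i \<in> ?J" "sqfree_exp A \<in> Poly_Mapping.keys (v i)"
      using keys_sum[of v ?J] by auto
    have "v i \<in> V i"
      using v(1) i(1) by (rule PiE_mem)
    then obtain g where "v i = g * u i"
      unfolding V_def stanley_space_def by blast
    then obtain r s where rs: "sqfree_exp A = r + s" "s \<in> Poly_Mapping.keys (u i)"
      using i(2) keys_mult[of g "u i"] by auto
    have "A = Poly_Mapping.keys r \<union> Poly_Mapping.keys s"
      using arg_cong[OF rs(1), of Poly_Mapping.keys] by (simp add: keys_add_nat)
    moreover have "d \<le> card (Poly_Mapping.keys s)"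
      using u_in[OF i(1)] rs(2) by (simp add: squarefree_veronese_ideal_eq)
    ultimately have keys_s: "Poly_Mapping.keys s = A"
      using A by (intro card_seteq) auto
    have "s = sqfree_exp A"
    proof (rule poly_mapping_eqI)
      fix l
      have "of_bool (l \<in> A) = Poly_Mapping.lookup r l + Poly_Mapping.lookup s l"
        using arg_cong[OF rs(1), of "\<lambda>t. Poly_Mapping.lookup t l"]
        by (simp add: lookup_sqfree_exp lookup_add)
      moreover have "l \<in> A \<longleftrightarrow> Poly_Mapping.lookup s l \<noteq> 0"
        using keys_s by (auto simp: in_keys_iff)
      ultimately show "Poly_Mapping.lookup s l = Poly_Mapping.lookup (sqfree_exp A) l"
        by (cases "l \<in> A") (simp_all add: lookup_sqfree_exp)
    qed
    then have "Poly_Mapping.keys (u i) = {sqfree_exp A}"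
      using rs(2) one_key[OF i(1)] by blast
    then have "u i = Poly_Mapping.single (sqfree_exp A) (Poly_Mapping.lookup (u i) (sqfree_exp A))"
      using poly_mapping_eq_sum_single[of "u i"] by simp
    moreover have "Poly_Mapping.lookup (u i) (sqfree_exp A) \<noteq> 0"
      using rs(2) \<open>s = sqfree_exp A\<close> by (simp add: in_keys_iff)
    ultimately show ?thesis
      using i(1) by blast
  qed
  then obtain idx c where idx: "\<And>A. card A = d \<Longrightarrow> idx A \<in> ?J"
    and c: "\<And>A. card A = d \<Longrightarrow> c A \<noteq> 0"
    and u_idx: "\<And>A. card A = d \<Longrightarrow> u (idx A) = Poly_Mapping.single (sqfree_exp A) (c A)"
    by metis
  have in_V: "Poly_Mapping.single (sqfree_exp (insert j A)) 1 \<in> V (idx A)"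
    if A: "card A = d" and j: "j \<in> Z (idx A) - A" for A j
  proof -
    have "Poly_Mapping.single j 1 + sqfree_exp A = sqfree_exp (insert j A)"
      using j by (intro poly_mapping_eqI)
        (auto simp: lookup_add lookup_single lookup_sqfree_exp when_def)
    then have "Poly_Mapping.single (sqfree_exp (insert j A)) 1
        = Poly_Mapping.single (Poly_Mapping.single j 1) (inverse (c A)) * u (idx A)"
      using c[OF A] by (simp add: u_idx[OF A] mult_single)
    moreover have "Poly_Mapping.single (Poly_Mapping.single j 1) (inverse (c A)) \<in> polys_in (Z (idx A))"
      using j by (simp add: polys_in_def)
    ultimately show ?thesis
      unfolding V_def stanley_space_def by blast
  qed
  have zero_V: "0 \<in> V l" for l
    unfolding V_def stanley_space_def by (rule image_eqI[of _ _ 0]) (auto simp: polys_in_def)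
  define D where "D = (SIGMA A:{A. card A = d}. Z (idx A) - A)"
  have "inj_on (\<lambda>(A, j). insert j A) D"
  proof (rule inj_onI, clarsimp simp: D_def)
    fix A j A' j'
    assume A: "d = card A" and j: "j \<in> Z (idx A)" "j \<notin> A"
      and A': "card A' = card A" and j': "j' \<in> Z (idx A')" "j' \<notin> A'"
      and eq: "insert j A = insert j' A'"
    have "idx A = idx A'"
    proof (rule ccontr)
      assume ne: "idx A \<noteq> idx A'"
      have "Poly_Mapping.single (sqfree_exp (insert j A)) 1 = (0 :: ('x, 'k) mpolynomial)"
        by (rule is_direct_sum_Int_zero[OF ds _ zero_V idx idx ne])
          (use in_V[of A j] in_V[of A' j'] A A' j j' eq in auto)
      then show False
        by (metis keys_single keys_zero zero_neq_one insert_not_empty)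
    qed
    then have "Poly_Mapping.keys (Poly_Mapping.single (sqfree_exp A) (c A))
        = Poly_Mapping.keys (Poly_Mapping.single (sqfree_exp A') (c A'))"
      using u_idx[of A] u_idx[of A'] A A' by simp
    then have "sqfree_exp A = sqfree_exp A'"
      using c[of A] c[of A'] A A' by simp
    then have "A = A'"
      by (metis keys_sqfree_exp)
    then show "A = A' \<and> j = j'"
      using eq j j' by blast
  qed
  moreover have "(\<lambda>(A, j). insert j A) ` D \<subseteq> {B. card B = d + 1}"
    by (auto simp: D_def)
  ultimately have "card D \<le> CARD('x) choose (d + 1)"
    using card_inj_on_le[of "\<lambda>(A, j). insert j A" D "{B. card B = d + 1}"]
    by (simp add: card_subsets_of_type del: add_is_1)
  moreover have "k * (CARD('x) choose d) \<le> card D"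
  proof -
    have "k \<le> card (Z (idx A) - A)" if "card A = d" for A
      using large[OF idx[OF that]] diff_card_le_card_Diff[of A "Z (idx A)"] that by simp
    then have "(\<Sum>A\<in>{A :: 'x set. card A = d}. k) \<le> (\<Sum>A\<in>{A. card A = d}. card (Z (idx A) - A))"
      by (intro sum_mono) simp
    also have "\<dots> = card D"
      by (simp add: D_def card_SigmaI)
    finally show ?thesis
      by (simp add: card_subsets_of_type mult.commute)
  qed
  ultimately show ?thesis
    by linarith
qed

lemma stanley_decomposition_length_pos:
  assumes "stanley_decomposition (*) multidegree_component
      (squarefree_veronese_ideal d :: ('x::finite, 'k::field) mpolynomial set) m u Z"
    and "d \<le> CARD('x)"
  shows "1 \<le> m"
proof (rule ccontr)
  assume "\<not> 1 \<le> m"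
  then have "bij_betw (\<lambda>v :: nat \<Rightarrow> ('x, 'k) mpolynomial. 0) {\<lambda>_. undefined}
      (squarefree_veronese_ideal d :: ('x, 'k) mpolynomial set)"
    using assms(1) by (simp add: stanley_decomposition_def is_direct_sum_def)
  then have "(squarefree_veronese_ideal d :: ('x, 'k) mpolynomial set) = {0}"
    by (auto simp: bij_betw_def)
  moreover have "Poly_Mapping.single (sqfree_exp UNIV) 1
      \<in> (squarefree_veronese_ideal d :: ('x, 'k) mpolynomial set)"
    using assms(2) by (simp add: squarefree_veronese_ideal_eq)
  ultimately have "Poly_Mapping.single (sqfree_exp (UNIV :: 'x set)) (1 :: 'k) = 0"
    by simp
  then show False
    by (metis keys_single keys_zero zero_neq_one insert_not_empty)
qed

lemma finite_stanley_depths: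
  assumes "d \<le> CARD('x)"
  shows "finite {sdepth_decomposition m Z | m u Z. stanley_decomposition (*) multidegree_component
    (squarefree_veronese_ideal d :: ('x::finite, 'k::field) mpolynomial set) m u Z}"
    (is "finite ?X")
proof (rule finite_subset)
  show "?X \<subseteq> {..CARD('x)}"
  proof
    fix s
    assume "s \<in> ?X"
    then obtain m u Z where s: "s = sdepth_decomposition m Z"
      and "stanley_decomposition (*) multidegree_component
        (squarefree_veronese_ideal d :: ('x, 'k) mpolynomial set) m u Z"
      by blast
    then have "1 \<le> m"
      using stanley_decomposition_length_pos assms by blast
    then have "s \<le> card (Z 1)"
      by (simp add: s sdepth_decomposition_def)
    also have "\<dots> \<le> CARD('x)"
      by (simp add: card_mono)
    finally show "s \<in> {..CARD('x)}"
      by simp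
  qed
qed simp

lemma sdepth_squarefree_veronese_ge:
  assumes "d \<le> CARD('x::finite)" "(k + 1) * (d + 1) \<le> CARD('x) + 1"
    "k * (d + 1) + (k - 1)\<^sup>2 \<le> CARD('x)"
  shows "d + k \<le> sdepth (*) multidegree_component
    (squarefree_veronese_ideal d :: ('x, 'k::field) mpolynomial set)"
proof (rule interval_partition[OF assms(2,3)])
  fix F :: "'x set set" and f
  assume F: "\<And>A. A \<in> F \<Longrightarrow> d \<le> card A" and f: "\<And>A. A \<subseteq> f A"
    and long: "\<And>A. A \<in> F \<Longrightarrow> d + k \<le> card (f A)"
    and part: "\<And>S. d \<le> card S \<Longrightarrow> \<exists>!A. A \<in> F \<and> A \<subseteq> S \<and> S \<subseteq> f A"
  show ?thesis
  proof (rule stanley_decomposition_of_interval_partition[OF F f part])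
    fix m and u :: "nat \<Rightarrow> ('x, 'k) mpolynomial" and Z
    assume sd: "stanley_decomposition (*) multidegree_component (squarefree_veronese_ideal d) m u Z"
      and Z: "\<And>i. i \<in> {1..m} \<Longrightarrow> \<exists>A\<in>F. Z i = f A"
    have "1 \<le> m"
      using sd assms(1) by (rule stanley_decomposition_length_pos)
    moreover have "d + k \<le> card (Z i)" if "i \<in> {1..m}" for i
      using Z[OF that] long by auto
    ultimately have "d + k \<le> sdepth_decomposition m Z"
      unfolding sdepth_decomposition_def by (subst Min_ge_iff) auto
    also have "\<dots> \<le> sdepth (*) multidegree_component
        (squarefree_veronese_ideal d :: ('x, 'k) mpolynomial set)"
      unfolding sdepth_def using sd by (intro Max_ge finite_stanley_depths assms(1)) blast
    finally show ?thesis .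
  qed
qed

lemma sdepth_squarefree_veronese_binomial_bound:
  assumes "d \<le> CARD('x::finite)"
    and "d + k \<le> sdepth (*) multidegree_component
      (squarefree_veronese_ideal d :: ('x, 'k::field) mpolynomial set)"
  shows "k * (CARD('x) choose d) \<le> CARD('x) choose (d + 1)"
proof -
  let ?I = "squarefree_veronese_ideal d :: ('x, 'k) mpolynomial set"
  let ?X = "{sdepth_decomposition m Z | m u Z. stanley_decomposition (*) multidegree_component ?I m u Z}"
  have "?X \<noteq> {}"
  proof (rule interval_partition[of 0 d])
    fix F :: "'x set set" and f
    assume F: "\<And>A. A \<in> F \<Longrightarrow> d \<le> card A" and f: "\<And>A. A \<subseteq> f A"
      and part: "\<And>S. d \<le> card S \<Longrightarrow> \<exists>!A. A \<in> F \<and> A \<subseteq> S \<and> S \<subseteq> f A"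
    show ?thesis
    proof (rule stanley_decomposition_of_interval_partition[OF F f part])
      fix m and u :: "nat \<Rightarrow> ('x, 'k) mpolynomial" and Z
      assume "stanley_decomposition (*) multidegree_component (squarefree_veronese_ideal d) m u Z"
      then have "sdepth_decomposition m Z \<in> ?X"
        by blast
      then show ?thesis
        by blast
    qed
  qed (use assms(1) in auto)
  then have "sdepth (*) multidegree_component ?I \<in> ?X"
    unfolding sdepth_def by (intro Max_in finite_stanley_depths assms(1))
  then obtain m u Z where eq: "sdepth (*) multidegree_component ?I = sdepth_decomposition m Z"
    and sd: "stanley_decomposition (*) multidegree_component ?I m u Z"
    by blast
  show ?thesis
  proof (rule stanley_decomposition_binomial_bound[OF sd])
    fix i
    assume "i \<in> {1..m}"
    then have "sdepth_decomposition m Z \<le> card (Z i)"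
      by (simp add: sdepth_decomposition_def)
    then show "d + k \<le> card (Z i)"
      using assms(2) eq by simp
  qed
qed

section \<open>Arithmetic of the two cases\<close>

lemma binomial_ratio:
  assumes "d \<le> n"
  shows "real (n choose (d + 1)) / real (n choose d) = (real n - real d) / (real d + 1)"
proof -
  have "(d + 1) * (n choose (d + 1)) = (n - d) * (n choose d)"
    using binomial_absorption[of d n] binomial_absorb_comp[of n d] by simp
  then have "real ((d + 1) * (n choose (d + 1))) = real ((n - d) * (n choose d))"
    by (rule arg_cong)
  then have "(real d + 1) * real (n choose (d + 1)) = (real n - real d) * real (n choose d)"
    using assms by (simp add: of_nat_diff algebra_simps)
  moreover have "real (n choose d) \<noteq> 0"
    using assms by simp
  ultimately show ?thesis
    by (simp add: field_simps)
qed

lemma le_sqrt_iff_power2_le: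
  assumes "0 \<le> y"
  shows "y \<le> sqrt x \<longleftrightarrow> y\<^sup>2 \<le> x"
  using assms real_sqrt_le_iff[of "y\<^sup>2" x] by simp

lemma le_floor_threshold_iff:
  assumes "1 \<le> k"
  shows "int k \<le> \<lfloor>(1 + sqrt (5 + 4 * real d)) / 2\<rfloor> \<longleftrightarrow> k * k \<le> d + k + 1"
proof -
  have "int k \<le> \<lfloor>(1 + sqrt (5 + 4 * real d)) / 2\<rfloor> \<longleftrightarrow> 2 * real k - 1 \<le> sqrt (5 + 4 * real d)"
    by (simp add: le_floor_iff) linarith
  also have "\<dots> \<longleftrightarrow> (2 * real k - 1)\<^sup>2 \<le> 5 + 4 * real d"
    using assms by (intro le_sqrt_iff_power2_le) simp
  also have "\<dots> \<longleftrightarrow> real (k * k) \<le> real (d + k + 1)"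
  proof -
    have "5 + 4 * real d - (2 * real k - 1)\<^sup>2 = 4 * (real (d + k + 1) - real (k * k))"
      by (simp add: power2_eq_square algebra_simps)
    then show ?thesis
      by argo
  qed
  finally show ?thesis
    by (simp only: of_nat_le_iff)
qed

lemma le_floor_quadratic_root_iff:
  "int (d + k) \<le> \<lfloor>(real d + sqrt ((real d)\<^sup>2 + 4 * (real n + 1))) / 2\<rfloor> \<longleftrightarrow> k * (d + k) \<le> n + 1"
proof -
  have "int (d + k) \<le> \<lfloor>(real d + sqrt ((real d)\<^sup>2 + 4 * (real n + 1))) / 2\<rfloor> \<longleftrightarrow>
      real d + 2 * real k \<le> sqrt ((real d)\<^sup>2 + 4 * (real n + 1))"
    by (simp add: le_floor_iff) linarith
  also have "\<dots> \<longleftrightarrow> (real d + 2 * real k)\<^sup>2 \<le> (real d)\<^sup>2 + 4 * (real n + 1)"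
    by (intro le_sqrt_iff_power2_le) simp
  also have "\<dots> \<longleftrightarrow> real (k * (d + k)) \<le> real (n + 1)"
  proof -
    have "(real d)\<^sup>2 + 4 * (real n + 1) - (real d + 2 * real k)\<^sup>2
        = 4 * (real (n + 1) - real (k * (d + k)))"
      by (simp add: power2_eq_square algebra_simps)
    then show ?thesis
      by argo
  qed
  finally show ?thesis
    by (simp only: of_nat_le_iff)
qed

theorem theorem1p2:
  fixes n d :: nat
    and I :: "('x::finite, 'k::field) mpolynomial set"
  assumes "CARD('x) = n"
    and "1 \<le> d" and "d \<le> n"
    and "I = squarefree_veronese_ideal d"
  shows "(int n \<le> (int d + 1) * \<lfloor>(1 + sqrt (5 + 4 * real d)) / 2\<rfloor> + 2 * int d \<longrightarrow>
            int (sdepth (*) multidegree_component I)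
              = \<lfloor>real (n choose (d + 1)) / real (n choose d)\<rfloor> + int d) \<and>
         (int n > (int d + 1) * \<lfloor>(1 + sqrt (5 + 4 * real d)) / 2\<rfloor> + 2 * int d \<longrightarrow>
            \<lfloor>(real d + sqrt ((real d)\<^sup>2 + 4 * (real n + 1))) / 2\<rfloor>
              \<le> int (sdepth (*) multidegree_component I) \<and>
            int (sdepth (*) multidegree_component I)
              \<le> \<lfloor>real (n choose (d + 1)) / real (n choose d)\<rfloor> + int d)"
proof -
  define s where "s = sdepth (*) multidegree_component I"
  define q where "q = \<lfloor>(1 + sqrt (5 + 4 * real d)) / 2\<rfloor>"
  define r where "r = \<lfloor>real (n choose (d + 1)) / real (n choose d)\<rfloor>"
  have lower: "d + k \<le> s" if "(k + 1) * (d + 1) \<le> n + 1" "k * (d + 1) + (k - 1)\<^sup>2 \<le> n" for k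
    unfolding s_def assms(4)
    using sdepth_squarefree_veronese_ge[where 'x = 'x and 'k = 'k, unfolded assms(1), OF assms(3) that] .
  \<comment> \<open>For \<open>k = 0\<close> the lower bound makes the subtraction in \<open>s - d\<close> exact.\<close>
  have "d \<le> s"
    using lower[of 0] assms(3) by simp
  have "(s - d) * (CARD('x) choose d) \<le> CARD('x) choose (d + 1)"
  proof (rule sdepth_squarefree_veronese_binomial_bound)
    show "d \<le> CARD('x)"
      using assms(1,3) by simp
    show "d + (s - d) \<le> sdepth (*) multidegree_component
        (squarefree_veronese_ideal d :: ('x, 'k) mpolynomial set)"
      using \<open>d \<le> s\<close> unfolding s_def assms(4) by simp
  qed
  then have "(s - d) * (n choose d) \<le> n choose (d + 1)"
    unfolding assms(1) .
  then have "real ((s - d) * (n choose d)) \<le> real (n choose (d + 1))"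
    by (rule of_nat_mono)
  then have "real (s - d) \<le> real (n choose (d + 1)) / real (n choose d)"
    using assms(3) by (simp add: le_divide_eq)
  then have "int (s - d) \<le> r"
    unfolding r_def le_floor_iff by simp
  then have upper: "int s \<le> r + int d"
    using \<open>d \<le> s\<close> by linarith
  have le_r: "int k \<le> r \<longleftrightarrow> (k + 1) * (d + 1) \<le> n + 1" for k
  proof -
    have "int k \<le> r \<longleftrightarrow> real k * (real d + 1) \<le> real n - real d"
      unfolding r_def binomial_ratio[OF assms(3)] by (simp add: le_floor_iff le_divide_eq)
    also have "\<dots> \<longleftrightarrow> real ((k + 1) * (d + 1)) \<le> real (n + 1)"
      by (simp add: algebra_simps)
    finally show ?thesis
      by (simp only: of_nat_le_iff)
  qed
  \<comment> \<open>Here \<open>r \<le> q\<close>, so \<open>r\<^sup>2 \<le> d + r + 1\<close>, and this turns the first hypothesis of the lower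
    bound for \<open>k = r\<close> into the second.\<close>
  have "int s = r + int d" if n: "int n \<le> (int d + 1) * q + 2 * int d"
  proof -
    have "0 \<le> r"
      by (simp add: r_def)
    then obtain k where k: "r = int k"
      using nonneg_int_cases by blast
    then have n_ge: "(k + 1) * (d + 1) \<le> n + 1"
      using le_r[of k] by simp
    have "k * (d + 1) + (k - 1)\<^sup>2 \<le> n"
    proof (cases "k \<le> 1")
      case True
      then show ?thesis
        using n_ge by (auto simp: le_Suc_eq)
    next
      case False
      have "int ((k + 1) * (d + 1)) \<le> int (n + 1)"
        using n_ge by (simp only: of_nat_le_iff)
      then have "(int d + 1) * int k < (int d + 1) * (q + 1)"
        using n by (simp add: algebra_simps)
      then have "int k \<le> q"
        by (simp add: mult_less_cancel_left_pos)
      then have "k * k \<le> d + k + 1"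
        using le_floor_threshold_iff[of k d] False by (simp add: q_def)
      obtain k' where "k = Suc (Suc k')"
        using False less_imp_Suc_add[of 1 k] by auto
      then show ?thesis
        using n_ge \<open>k * k \<le> d + k + 1\<close> by (simp add: power2_eq_square algebra_simps)
    qed
    then show ?thesis
      using lower[OF n_ge] upper k by simp
  qed
  moreover have "\<lfloor>(real d + sqrt ((real d)\<^sup>2 + 4 * (real n + 1))) / 2\<rfloor> \<le> int s"
    (is "?b \<le> _") if n: "int n > (int d + 1) * q + 2 * int d"
  proof -
    have "int (d + 0) \<le> ?b"
      by (subst le_floor_quadratic_root_iff) simp
    then obtain k where "?b - int d = int k"
      using nonneg_int_cases[of "?b - int d"] by auto
    then have b: "?b = int (d + k)"
      by simp
    then have k: "k * (d + k) \<le> n + 1"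
      using le_floor_quadratic_root_iff[of d k n] by simp
    \<comment> \<open>Otherwise \<open>k (d + k) \<le> n + 1 < (k + 1)(d + 1)\<close> would give \<open>k \<le> q\<close>, against the size of \<open>n\<close>.\<close>
    have n_ge: "(k + 1) * (d + 1) \<le> n + 1"
    proof (rule ccontr)
      assume small: "\<not> ?thesis"
      then have "1 \<le> k"
        using assms(3) by (cases k) auto
      moreover have "k * k \<le> d + k + 1"
        using k small by (simp add: algebra_simps)
      ultimately have "int k \<le> q"
        by (simp add: le_floor_threshold_iff q_def)
      then have "(int d + 1) * int k \<le> (int d + 1) * q"
        by (intro mult_left_mono) auto
      then have "(int k + 1) * (int d + 1) \<le> int n + 1"
        using n by (simp add: algebra_simps)
      then have "int ((k + 1) * (d + 1)) \<le> int (n + 1)"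
        by (simp add: algebra_simps)
      then show False
        using small by (simp only: of_nat_le_iff)
    qed
    have "k * (d + 1) + (k - 1)\<^sup>2 \<le> n"
    proof (cases "k \<le> 1")
      case True
      then show ?thesis
        using n_ge by (auto simp: le_Suc_eq)
    next
      case False
      obtain k' where "k = Suc (Suc k')"
        using False less_imp_Suc_add[of 1 k] by auto
      then show ?thesis
        using k by (simp add: power2_eq_square algebra_simps)
    qed
    then show ?thesis
      using lower[OF n_ge] b by simp
  qed
  ultimately show ?thesis
    using upper by (simp add: s_def q_def r_def)
qed

end
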